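(* Let $n\ge 1$, let $m$ be a non-negative integer, let $\alpha>0$, let $0<p\leq q<\infty$, and let $\mu\geq 0$ be a positive Borel measure on $\mathbb{C}^n$. Then the following statements are equivalent. (i) $\mu$ is a $(p,q)$ vanishing Fock--Carleson measure for the Fock--Sobolev spaces of order $m$; (ii) $\widetilde{\mu}_{(t,mq)}(z)\to 0$ as $|z|\to\infty$ for some (or any) $t>0$; (iii) $\mu_{(mq,r,D)}(z)\to 0$ as $|z|\to\infty$ for some (or any) $r>0$; (iv) $\mu_{(mq,r,D)}(z_k)\to 0$ as $k\to\infty$ for some (or any) $r>0$.
   Context: $dV$ is Lebesgue measure on $\mathbb{C}^n$, $\langle z,w\rangle=\sum_j z_j\overline{w_j}$, $|z|=\sqrt{\langle z,z\rangle}$. For $0<p<\infty$ put $\|f\|_p^p=(\frac{\alpha p}{2\pi})^n\int_{\mathbb{C}^n}|f(z)|^pe^{-\frac{\alpha p}{2}|z|^2}dV(z)$. The Fock--Sobolev space $\mathcal{F}^p_{(m,\alpha)}$ of order $m$ consists of the entire functions $f$ on $\mathbb{C}^n$ with $\sum_{\beta_1+\dots+\beta_n\le m}\|\partial^\beta f\|_p<\infty$. It is equipped throughout with the equivalent (quasi-)norm $\|f\|_{(p,m)}=\big(C_{(p,m,n)}\int_{\mathbb{C}^n}|z|^{mp}|f(z)|^pe^{-\frac{\alpha p}{2}|z|^2}dV(z)\big)^{1/p}$, where $C_{(p,m,n)}=(\frac{\alpha p}{2})^{\frac{mp}{2}+n}\frac{\Gamma(n)}{\pi^n\Gamma(\frac{mp}{2}+n)}$.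 $\mu$ is a $(p,q)$ vanishing Fock--Carleson measure if $\lim_{j\to\infty}\int_{\mathbb{C}^n}|f_j(z)|^qe^{-\frac{q\alpha}{2}|z|^2}d\mu(z)=0$ whenever $(f_j)$ is a sequence in $\mathcal{F}^p_{(m,\alpha)}$ with $\sup_j\|f_j\|_{(p,m)}<\infty$ that converges to zero uniformly on compact subsets of $\mathbb{C}^n$ as $j\to\infty$. For $t>0$, $s\ge 0$, the $(t,s)$-Berezin type transform is $\widetilde{\mu}_{(t,s)}(w)=\int_{\mathbb{C}^n}(1+|z|)^{-s}e^{-\frac{t\alpha}{2}|z-w|^2}d\mu(z)$. With $D(z,r)=\{w\in\mathbb{C}^n:|z-w|<r\}$, put $\mu_{(s,r,D)}(z)=\mu(D(z,r))/(1+|z|)^s$. A sequence of distinct points $(z_k)_{k\in\mathbb{N}}$ is an $r/2$-lattice for $\mathbb{C}^n$ if the balls $D(z_k,r)$ cover $\mathbb{C}^n$ and the balls $D(z_k,r/2)$ are mutually disjoint. In conditions involving $(z_k)$ and $r$, $(z_k)$ is an $r/2$-lattice for that $r$. "For some (or any)" means that the condition for one value of the parameter is equivalent to the condition for every value.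
   Formalization: The positive Borel measure μ is additionally assumed finite on compact sets; without this the claim fails, e.g. for an infinite point mass at 0, which satisfies (iii) and (iv) but neither (i) nor (ii). *)

theory Defs
  imports "HOL-Analysis.Analysis"
begin

text \<open>
  The space of \<open>n\<close> complex variables is \<^typ>\<open>complex ^ 'n\<close> with \<open>n = CARD('n)\<close>; its library norm is
  the Euclidean one, and \<open>lborel\<close> on it is Lebesgue measure (restricted to Borel sets). Integrals of
  nonnegative functions are taken in \<^typ>\<open>ennreal\<close>, so that an infinite value is never confused
  with a finite one.
\<close>

text \<open>
  A positive Borel measure, with the usual convention that it is finite on compact sets. Without
  this convention the equivalences below fail: if \<open>\<mu> {0} = \<infinity>\<close> and \<open>\<mu> (- {0}) = 0\<close>, then
  \<open>\<mu> (ball z r) = 0\<close> whenever \<open>norm z \<ge> r\<close>, but the Berezin type transforms of \<open>\<mu>\<close> are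
  identically \<open>\<infinity>\<close>.
\<close>
definition positive_borel_measure :: "(complex ^ 'n) measure \<Rightarrow> bool" where
  "positive_borel_measure \<mu> \<longleftrightarrow>
     sets \<mu> = sets borel \<and> (\<forall>K. compact K \<longrightarrow> emeasure \<mu> K < \<infinity>)"

definition entire :: "(complex ^ 'n \<Rightarrow> complex) \<Rightarrow> bool" where
  "entire f \<longleftrightarrow>
     (\<forall>z. \<exists>L. (f has_derivative L) (at z) \<and> (\<forall>c v. L (c *s v) = c * L v))"

definition cpartial :: "'n \<Rightarrow> (complex ^ 'n \<Rightarrow> complex) \<Rightarrow> complex ^ 'n \<Rightarrow> complex" where
  "cpartial i f z = deriv (\<lambda>w. f (z + axis i w)) 0"

text \<open>
  The partial derivatives of an entire function commute, so the (arbitrary) order in which the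
  coordinates are enumerated does not matter for \<open>multi_partial\<close>.
\<close>
definition coord_enum :: "'n::finite list" where
  "coord_enum = (SOME is. distinct is \<and> set is = UNIV)"

definition multi_partial ::
    "('n \<Rightarrow> nat) \<Rightarrow> (complex ^ 'n \<Rightarrow> complex) \<Rightarrow> complex ^ 'n \<Rightarrow> complex" where
  "multi_partial \<beta> f = foldr (\<lambda>i. cpartial i ^^ \<beta> i) coord_enum f"

text \<open>The power \<open>x\<^sup>a\<close> for \<open>a > 0\<close>, with \<open>\<infinity>\<^sup>a = \<infinity>\<close>.\<close>
definition ennreal_rpow :: "ennreal \<Rightarrow> real \<Rightarrow> ennreal" where
  "ennreal_rpow x a = (if x = \<infinity> then \<infinity> else ennreal (enn2real x powr a))"

definition fock_norm :: "real \<Rightarrow> real \<Rightarrow> (complex ^ 'n \<Rightarrow> complex) \<Rightarrow> ennreal" where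
  "fock_norm \<alpha> p f =
     ennreal_rpow
       (ennreal ((\<alpha> * p / (2 * pi)) ^ CARD('n)) *
        (\<integral>\<^sup>+z. ennreal (norm (f z) powr p * exp (- (\<alpha> * p / 2) * (norm z)\<^sup>2)) \<partial>lborel))
       (1 / p)"

definition fock_sobolev :: "real \<Rightarrow> nat \<Rightarrow> real \<Rightarrow> (complex ^ 'n \<Rightarrow> complex) set" where
  "fock_sobolev p m \<alpha> =
     {f. entire f \<and>
         (\<Sum>\<beta> | (\<Sum>i\<in>UNIV. \<beta> i) \<le> m. fock_norm \<alpha> p (multi_partial \<beta> f)) < \<infinity>}"

lemma finite_multi_indices: "finite {\<beta> :: 'n::finite \<Rightarrow> nat. (\<Sum>i\<in>UNIV. \<beta> i) \<le> m}"
proof (rule finite_subset)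
  show "{\<beta> :: 'n \<Rightarrow> nat. (\<Sum>i\<in>UNIV. \<beta> i) \<le> m} \<subseteq> (\<Pi>\<^sub>E i\<in>UNIV. {..m})"
  proof
    fix \<beta> :: "'n \<Rightarrow> nat"
    assume "\<beta> \<in> {\<beta>. (\<Sum>i\<in>UNIV. \<beta> i) \<le> m}"
    moreover have "\<beta> i \<le> (\<Sum>i\<in>UNIV. \<beta> i)" for i
      by (rule member_le_sum) auto
    ultimately show "\<beta> \<in> (\<Pi>\<^sub>E i\<in>UNIV. {..m})"
      by (auto simp: PiE_def Pi_def intro: le_trans)
  qed
  show "finite (\<Pi>\<^sub>E i\<in>(UNIV :: 'n set). {..m})"
    by (rule finite_PiE) auto
qed

definition fock_sobolev_const :: "real \<Rightarrow> nat \<Rightarrow> real \<Rightarrow> nat \<Rightarrow> real" where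
  "fock_sobolev_const p m \<alpha> n =
     (\<alpha> * p / 2) powr (real m * p / 2 + real n) *
     (Gamma (real n) / (pi ^ n * Gamma (real m * p / 2 + real n)))"

text \<open>
  The weight \<open>|z|\<^sup>m\<^sup>p\<close> is written \<open>(norm z ^ m) powr p\<close>, so that it is \<open>1\<close> for \<open>m = 0\<close> also at the
  origin (\<open>0 powr 0 = 0\<close>).
\<close>
definition fock_sobolev_norm ::
    "real \<Rightarrow> nat \<Rightarrow> real \<Rightarrow> (complex ^ 'n \<Rightarrow> complex) \<Rightarrow> ennreal" where
  "fock_sobolev_norm p m \<alpha> f =
     ennreal_rpow
       (ennreal (fock_sobolev_const p m \<alpha> CARD('n)) *
        (\<integral>\<^sup>+z. ennreal ((norm z ^ m) powr p * norm (f z) powr p *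
                 exp (- (\<alpha> * p / 2) * (norm z)\<^sup>2)) \<partial>lborel))
       (1 / p)"

definition vanishing_fock_carleson ::
    "real \<Rightarrow> real \<Rightarrow> nat \<Rightarrow> real \<Rightarrow> (complex ^ 'n) measure \<Rightarrow> bool" where
  "vanishing_fock_carleson p q m \<alpha> \<mu> \<longleftrightarrow>
     (\<forall>f :: nat \<Rightarrow> complex ^ 'n \<Rightarrow> complex.
        (\<forall>j. f j \<in> fock_sobolev p m \<alpha>) \<longrightarrow>
        (SUP j. fock_sobolev_norm p m \<alpha> (f j)) < \<infinity> \<longrightarrow>
        (\<forall>K. compact K \<longrightarrow> uniform_limit K f (\<lambda>z. 0) sequentially) \<longrightarrow>
        (\<lambda>j. \<integral>\<^sup>+z. ennreal (norm (f j z) powr q * exp (- (q * \<alpha> / 2) * (norm z)\<^sup>2)) \<partial>\<mu>)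
          \<longlonglongrightarrow> 0)"

definition berezin_transform ::
    "real \<Rightarrow> real \<Rightarrow> real \<Rightarrow> (complex ^ 'n) measure \<Rightarrow> complex ^ 'n \<Rightarrow> ennreal" where
  "berezin_transform \<alpha> t s \<mu> w =
     (\<integral>\<^sup>+z. ennreal ((1 + norm z) powr (- s) * exp (- (t * \<alpha> / 2) * (norm (z - w))\<^sup>2)) \<partial>\<mu>)"

definition averaging_function ::
    "real \<Rightarrow> real \<Rightarrow> (complex ^ 'n) measure \<Rightarrow> complex ^ 'n \<Rightarrow> ennreal" where
  "averaging_function s r \<mu> z = emeasure \<mu> (ball z r) / ennreal ((1 + norm z) powr s)"

definition half_lattice :: "real \<Rightarrow> (nat \<Rightarrow> complex ^ 'n) \<Rightarrow> bool" where
  "half_lattice r z \<longleftrightarrow>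
     inj z \<and> (\<Union>k. ball (z k) r) = UNIV \<and> disjoint_family (\<lambda>k. ball (z k) (r / 2))"

end

theory Submission
  imports Defs
    "HOL-Complex_Analysis.Cauchy_Integral_Formula"
    "HOL-Probability.Distributions"
    "HOL-Real_Asymp.Real_Asymp"
begin

text \<open>
  The averages of \<open>\<mu>\<close> over balls of radius \<open>r\<close>, weighted by \<open>(1 + norm z) powr - (m * q)\<close>, are the
  quantities that decide everything; the averages at the points of a lattice are the weakest condition
  on them. The proof is a cycle through that condition.

  Necessity rests on one family of test functions. The normalised reproducing kernel at \<open>w\<close> has modulus
  \<open>exp (- \<alpha> / 2 * (norm (z - w))\<^sup>2)\<close> after multiplication by the weight of the Fock space. Divided by
  \<open>(1 + norm w) ^ m\<close> these functions are bounded in the Fock-Sobolev norm and tend to 0 locally uniformly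
  as \<open>w\<close> goes to infinity, and their integrals with respect to \<open>\<mu>\<close> dominate the averages at \<open>w\<close>
  (\<open>vanishing_imp_averaging\<close>). The Berezin type transforms are such integrals up to the position of the
  weight, and they dominate the averages as well (\<open>berezin_imp_averaging\<close>). Both
  arguments work for every radius, and since the points of a lattice go to infinity, the averages over
  lattice balls tend to 0, too.

  Sufficiency rests on the sub-mean value property \<open>fock_weighted_submean\<close>: the value of
  \<open>(norm f * exp (- \<alpha> / 2 * (norm z)\<^sup>2)) powr p\<close> at a point is at most a constant times its integral over a
  ball of fixed radius, uniformly in the centre and for every \<open>p > 0\<close>. It turns an integral over a
  lattice ball with respect to \<open>\<mu>\<close> into the average of \<open>\<mu>\<close> over that ball times a local Lebesgue integral
  of \<open>f\<close>. As enlarged lattice balls overlap boundedly often, these local integrals add up to at most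
  a multiple of the \<open>p\<close>-th power of the norm of \<open>f\<close>. The \<open>q\<close>-integrals bring in their powers with
  exponent \<open>q / p\<close>; since \<open>p \<le> q\<close>, these are at most multiples of the local integrals themselves. The
  averages are small except for finitely many balls, where local uniform convergence helps
  (\<open>carleson_sequence_tendsto_0\<close>). The Berezin type transforms with parameter \<open>t\<close> are covered by the
  same statement, applied to the test functions themselves with both exponents equal to \<open>t / 2\<close>
  (\<open>lattice_imp_berezin\<close>).

  The sub-mean value property is proved from Cauchy's formula on complex lines, the rotation
  invariance of Lebesgue measure, and a maximum argument that covers exponents below 1
  (\<open>small_exponent_submean\<close>).
\<close>

section \<open>Lebesgue measure: orthogonal invariance and Gaussians\<close>

lemma pred_mem_ball [measurable]:
  fixes c :: "'a::euclidean_space"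
  shows "Measurable.pred borel (\<lambda>x. x \<in> ball c r)"
  unfolding pred_def space_borel by (simp del: mem_ball)

lemma pred_mem_cball [measurable]:
  fixes c :: "'a::euclidean_space"
  shows "Measurable.pred borel (\<lambda>x. x \<in> cball c r)"
  unfolding pred_def space_borel by (simp del: mem_cball)

lemma nn_integral_lborel_translate:
  fixes f :: "'a::euclidean_space \<Rightarrow> ennreal"
  assumes [measurable]: "f \<in> borel_measurable borel"
  shows "(\<integral>\<^sup>+x. f (t + x) \<partial>lborel) = (\<integral>\<^sup>+x. f x \<partial>lborel)"
proof -
  have "(\<integral>\<^sup>+x. f x \<partial>lborel) = (\<integral>\<^sup>+x. f x \<partial>(distr lborel borel (\<lambda>x. t + x)))"
    using lborel_affine[of 1 t] by (simp add: density_1)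
  then show ?thesis by (simp add: nn_integral_distr)
qed

lemma nn_integral_lborel_reflect:
  fixes f :: "'a::euclidean_space \<Rightarrow> ennreal"
  assumes [measurable]: "f \<in> borel_measurable borel"
  shows "(\<integral>\<^sup>+x. f (t - x) \<partial>lborel) = (\<integral>\<^sup>+x. f x \<partial>lborel)"
proof -
  have "(\<integral>\<^sup>+x. f x \<partial>lborel) = (\<integral>\<^sup>+x. f x \<partial>(distr lborel borel (\<lambda>x. t - x)))"
    using lborel_affine[of "-1" t] by (simp add: density_1)
  then show ?thesis by (simp add: nn_integral_distr)
qed

lemma emeasure_lborel_ball_nonzero:
  fixes c :: "'a::euclidean_space"
  shows "r > 0 \<Longrightarrow> emeasure lborel (ball c r) \<noteq> 0"
  by (simp add: emeasure_ball unit_ball_vol_pos less_imp_neq[symmetric])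

text \<open>
  Both \<open>f \<mapsto> \<integral> f (T x) dx\<close> and \<open>f \<mapsto> \<integral> f x dx\<close> are translation invariant, hence proportional, and
  they agree on the unit ball, which \<open>T\<close> preserves. The proportionality is the usual uniqueness
  argument for Haar measure: evaluate the double integral of \<open>f x * B (T y - x)\<close>, with \<open>B\<close> the
  indicator of the unit ball, in both orders.
\<close>

lemma nn_integral_lborel_orthogonal:
  fixes f :: "'a::euclidean_space \<Rightarrow> ennreal" and T :: "'a \<Rightarrow> 'a"
  assumes T: "orthogonal_transformation T" and f [measurable]: "f \<in> borel_measurable borel"
  shows "(\<integral>\<^sup>+x. f (T x) \<partial>lborel) = (\<integral>\<^sup>+x. f x \<partial>lborel)"
proof -
  define B :: "'a \<Rightarrow> ennreal" where "B = indicator (ball 0 1)"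
  have [measurable]: "B \<in> borel_measurable borel"
    unfolding B_def by (intro borel_measurable_indicator) simp
  let ?b = "emeasure lborel (ball (0::'a) 1)"
  have T_lin: "linear T"
    using T orthogonal_transformation_linear by blast
  have [measurable]: "T \<in> borel_measurable borel"
    using T_lin by (intro borel_measurable_continuous_onI linear_continuous_on) (simp add: linear_linear)
  have T_norm: "norm (T x) = norm x" for x
    using T by (simp add: orthogonal_transformation_norm)
  obtain S where S: "\<And>x. T (S x) = x"
    using surj_f_inv_f[OF orthogonal_transformation_surj[OF T]] by blast
  have vol: "(\<integral>\<^sup>+y. B (T y - x) \<partial>lborel) = ?b" for x
  proof -
    have "B (T y - x) = B (- S x + y)" for y
    proof -
      have "T y - x = T (- S x + y)"
        using S by (simp add: linear_diff[OF T_lin])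
      then show ?thesis by (simp add: T_norm indicator_def B_def)
    qed
    then have "(\<integral>\<^sup>+y. B (T y - x) \<partial>lborel) = (\<integral>\<^sup>+y. B (- S x + y) \<partial>lborel)" by simp
    also have "\<dots> = (\<integral>\<^sup>+y. B y \<partial>lborel)"
      by (rule nn_integral_lborel_translate) simp
    finally show ?thesis by (simp add: B_def)
  qed
  have shift: "(\<integral>\<^sup>+y. f (T y - v) \<partial>lborel) = (\<integral>\<^sup>+y. f (T y) \<partial>lborel)" for v
  proof -
    have "T y - v = T (- S v + y)" for y
      using S by (simp add: linear_diff[OF T_lin])
    then have "(\<integral>\<^sup>+y. f (T y - v) \<partial>lborel) = (\<integral>\<^sup>+y. f (T (- S v + y)) \<partial>lborel)" by simp
    also have "\<dots> = (\<integral>\<^sup>+y. f (T y) \<partial>lborel)" by (rule nn_integral_lborel_translate) simp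
    finally show ?thesis .
  qed
  have "(\<integral>\<^sup>+x. f x \<partial>lborel) * ?b = (\<integral>\<^sup>+x. f x * ?b \<partial>lborel)"
    by (simp add: nn_integral_multc)
  also have "\<dots> = (\<integral>\<^sup>+x. (\<integral>\<^sup>+y. f x * B (T y - x) \<partial>lborel) \<partial>lborel)"
    by (simp add: nn_integral_cmult vol)
  also have "\<dots> = (\<integral>\<^sup>+y. (\<integral>\<^sup>+x. f x * B (T y - x) \<partial>lborel) \<partial>lborel)"
    by (rule lborel_pair.Fubini') measurable
  also have "\<dots> = (\<integral>\<^sup>+y. (\<integral>\<^sup>+v. f (T y - v) * B v \<partial>lborel) \<partial>lborel)"
  proof (rule nn_integral_cong)
    fix y
    show "(\<integral>\<^sup>+x. f x * B (T y - x) \<partial>lborel) = (\<integral>\<^sup>+v. f (T y - v) * B v \<partial>lborel)"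
      using nn_integral_lborel_reflect[of "\<lambda>x. f x * B (T y - x)" "T y"] by simp
  qed
  also have "\<dots> = (\<integral>\<^sup>+v. (\<integral>\<^sup>+y. f (T y - v) * B v \<partial>lborel) \<partial>lborel)"
    by (rule lborel_pair.Fubini') measurable
  also have "\<dots> = (\<integral>\<^sup>+v. (\<integral>\<^sup>+y. f (T y) \<partial>lborel) * B v \<partial>lborel)"
    by (simp add: nn_integral_multc shift)
  also have "\<dots> = (\<integral>\<^sup>+y. f (T y) \<partial>lborel) * ?b"
    by (simp add: nn_integral_cmult_indicator B_def)
  finally show ?thesis
    using emeasure_lborel_ball_nonzero[of 1 "0::'a"] emeasure_lborel_ball_finite[of "0::'a" 1]
    by (auto simp: ennreal_mult_cancel_left mult.commute[of _ "emeasure _ _"])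
qed

text \<open>
  The Gaussian is the product over the coordinates of multiples of one-dimensional normal densities.
\<close>

lemma nn_integral_gaussian_finite:
  fixes w :: "'a::euclidean_space"
  assumes "a > 0"
  shows "(\<integral>\<^sup>+x. ennreal (exp (- a * (norm (x - w))\<^sup>2)) \<partial>lborel) < \<infinity>"
proof -
  have one: "(\<integral>\<^sup>+x. ennreal (exp (- a * x\<^sup>2)) \<partial>(lborel :: real measure)) < \<infinity>"
  proof -
    define \<sigma> where "\<sigma> = sqrt (1 / (2 * a))"
    have \<sigma>: "\<sigma> > 0" "\<sigma>\<^sup>2 = 1 / (2 * a)" using assms by (auto simp: \<sigma>_def)
    have "(\<integral>\<^sup>+x. ennreal (exp (- a * x\<^sup>2)) \<partial>(lborel :: real measure))
        = (\<integral>\<^sup>+x. ennreal (sqrt (2 * pi * \<sigma>\<^sup>2)) * ennreal (normal_density 0 \<sigma> x) \<partial>(lborel :: real measure))"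
      using assms \<sigma> by (intro nn_integral_cong)
        (simp add: normal_density_def ennreal_mult[symmetric] field_simps)
    also have "\<dots> = ennreal (sqrt (2 * pi * \<sigma>\<^sup>2)) * (\<integral>\<^sup>+x. ennreal (normal_density 0 \<sigma> x) \<partial>(lborel :: real measure))"
      by (rule nn_integral_cmult) simp
    also have "\<dots> < \<infinity>"
      using integrable_normal_density[OF \<sigma>(1), of 0] \<sigma>(1)
      by (subst nn_integral_eq_integral) (auto simp: ennreal_mult_less_top)
    finally show ?thesis .
  qed
  have "(\<integral>\<^sup>+x. ennreal (exp (- a * (norm (x - w))\<^sup>2)) \<partial>lborel)
      = (\<integral>\<^sup>+x. ennreal (exp (- a * (norm x)\<^sup>2)) \<partial>(lborel :: 'a measure))"
    using nn_integral_lborel_translate[of "\<lambda>x. ennreal (exp (- a * (norm x)\<^sup>2))" "- w"] by simp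
  also have "\<dots> = (\<integral>\<^sup>+x. (\<Prod>b\<in>Basis. ennreal (exp (- a * (x \<bullet> b)\<^sup>2))) \<partial>(lborel :: 'a measure))"
  proof (rule nn_integral_cong)
    fix x :: 'a
    have "(norm x)\<^sup>2 = (\<Sum>b\<in>Basis. (x \<bullet> b)\<^sup>2)"
      by (simp add: norm_eq_sqrt_inner euclidean_inner[of x x] power2_eq_square sum_nonneg)
    then show "ennreal (exp (- a * (norm x)\<^sup>2)) = (\<Prod>b\<in>Basis. ennreal (exp (- a * (x \<bullet> b)\<^sup>2)))"
      by (simp add: prod_ennreal exp_sum[symmetric] sum_distrib_left sum_negf)
  qed
  also have "\<dots> = (\<Prod>b\<in>(Basis :: 'a set). (\<integral>\<^sup>+x. ennreal (exp (- a * x\<^sup>2)) \<partial>(lborel :: real measure)))"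
    by (rule nn_integral_lborel_prod) auto
  also have "\<dots> < \<infinity>"
    using one by (simp add: power_less_top_ennreal)
  finally show ?thesis .
qed

section \<open>Mean values of entire functions of several variables\<close>

lemma norm_vector_scalar_mult: "norm (c *s v) = norm c * norm (v :: complex ^ 'n)"
  by (simp add: norm_vec_def norm_mult L2_set_right_distrib)

lemma orthogonal_transformation_unit_scale:
  assumes "norm c = 1"
  shows "orthogonal_transformation (\<lambda>v :: complex ^ 'n. c *s v)"
  unfolding orthogonal_transformation
proof
  show "linear (\<lambda>v :: complex ^ 'n. c *s v)"
    by (rule linearI) (simp_all add: vec_eq_iff algebra_simps)
qed (simp add: norm_vector_scalar_mult assms)

lemma entire_continuous_on: "entire f \<Longrightarrow> continuous_on S f"
  unfolding entire_def
  by (meson continuous_at_imp_continuous_on has_derivative_continuous)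

lemma entire_borel_measurable: "entire f \<Longrightarrow> f \<in> borel_measurable borel"
  by (simp add: entire_continuous_on borel_measurable_continuous_onI)

text \<open>
  Restriction to a complex line reduces the several-variable mean value property to one variable.
\<close>

lemma entire_along_line:
  assumes "entire f"
  shows "(\<lambda>c. f (z + c *s u)) holomorphic_on S"
proof (rule holomorphic_on_subset[OF _ subset_UNIV], subst holomorphic_on_open, simp, intro ballI)
  fix c :: complex
  obtain L where L: "(f has_derivative L) (at (z + c *s u))" "\<And>c v. L (c *s v) = c * L v"
    using assms unfolding entire_def by blast
  have "((\<lambda>c. z + c *s u) has_derivative (\<lambda>h. h *s u)) (at c)"
  proof -
    have "bounded_linear (\<lambda>c. c *s u)"
    proof (rule bounded_linear_intro)
      show "norm (c *s u) \<le> norm c * norm u" for c by (simp add: norm_vector_scalar_mult)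
    qed (simp_all add: vec_eq_iff algebra_simps)
    then have "((\<lambda>c. c *s u) has_derivative (\<lambda>h. h *s u)) (at c)"
      by (rule bounded_linear_imp_has_derivative)
    from has_derivative_add[OF has_derivative_const this] show ?thesis by simp
  qed
  from has_derivative_compose[OF this, of f L] L(1)
  have "((\<lambda>c. f (z + c *s u)) has_derivative (\<lambda>h. L (h *s u))) (at c)" by simp
  moreover have "(\<lambda>h. L (h *s u)) = (*) (L u)"
    by (simp add: fun_eq_iff L(2) mult.commute)
  ultimately have "((\<lambda>c. f (z + c *s u)) has_field_derivative L u) (at c)"
    by (simp add: has_field_derivative_def)
  then show "\<exists>f'. ((\<lambda>c. f (z + c *s u)) has_field_derivative f') (at c)" ..
qed

text \<open>
  Cauchy's formula on the unit circle.
\<close>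

lemma norm_le_circle_mean:
  assumes "g holomorphic_on UNIV"
  shows "ennreal (norm (g 0)) \<le> (\<integral>\<^sup>+\<theta>. ennreal (norm (g (cis (2 * pi * \<theta>)))) * indicator {0..1} \<theta> \<partial>lborel)"
proof -
  let ?h = "\<lambda>\<theta>::real. g (cis (2 * pi * \<theta>))"
  have cont: "continuous_on UNIV ?h"
    using holomorphic_on_imp_continuous_on[OF assms]
    by (auto intro!: continuous_on_compose2[of UNIV g] continuous_intros simp: cis_conv_exp)
  have "((\<lambda>u. g u / (u - 0)) has_contour_integral (2 * of_real pi * \<i> * g 0)) (circlepath 0 1)"
    using assms by (intro Cauchy_integral_circlepath_simple) (auto intro: holomorphic_on_subset)
  then have "((\<lambda>x::real. g (exp (2 * of_real pi * \<i> * x)) / exp (2 * of_real pi * \<i> * x) *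
       (2 * of_real pi * \<i> * exp (2 * of_real pi * \<i> * x))) has_integral (2 * of_real pi * \<i> * g 0)) {0..1}"
    unfolding has_contour_integral_def
    by (rule has_integral_eq[rotated]) (simp add: vector_derivative_circlepath01, simp add: circlepath)
  then have "((\<lambda>x. (2 * of_real pi * \<i>) * ?h x) has_integral (2 * of_real pi * \<i> * g 0)) {0..1}"
    by (rule has_integral_eq[rotated]) (simp add: cis_conv_exp mult_ac)
  from has_integral_mult_right[OF this, of "1 / (2 * of_real pi * \<i>)"]
  have I: "(?h has_integral g 0) {0..1}" by simp
  have "(\<lambda>\<theta>. norm (?h \<theta>)) integrable_on {0..1}"
    by (intro integrable_continuous_real continuous_intros continuous_on_subset[OF cont]) auto
  then have N: "((\<lambda>\<theta>. norm (?h \<theta>)) has_integral integral {0..1} (\<lambda>\<theta>. norm (?h \<theta>))) {0..1}"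
    by (rule integrable_integral)
  have "norm (g 0) \<le> integral {0..1} (\<lambda>\<theta>. norm (?h \<theta>))"
    using integral_norm_bound_integral[OF has_integral_integrable[OF I] has_integral_integrable[OF N]]
    by (simp add: integral_unique[OF I])
  then show ?thesis
    using nn_integral_has_integral_lebesgue'[OF _ N] by (simp add: ennreal_leI)
qed

text \<open>
  The circle estimate holds on every complex line through \<open>z\<close>. Integrating it over all directions
  \<open>u\<close> in the ball and exchanging the integrals replaces the circle average by a plain integral
  over the ball, since each rotation \<open>u \<mapsto> cis \<theta> *s u\<close> preserves Lebesgue measure.
\<close>

lemma entire_ball_mean:
  fixes f :: "complex ^ 'n \<Rightarrow> complex"
  assumes "entire f"
  shows "ennreal (norm (f z)) * emeasure lborel (ball z \<rho>)
     \<le> (\<integral>\<^sup>+u. ennreal (norm (f u)) * indicator (ball z \<rho>) u \<partial>lborel)"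
proof -
  define B :: "complex ^ 'n \<Rightarrow> ennreal" where "B = indicator (ball 0 \<rho>)"
  define G where "G = (\<lambda>v. ennreal (norm (f (z + v))) * B v)"
  have [measurable]: "f \<in> borel_measurable borel"
    using assms by (rule entire_borel_measurable)
  have B [measurable]: "B \<in> borel_measurable borel"
    unfolding B_def by (intro borel_measurable_indicator) simp
  have G [measurable]: "G \<in> borel_measurable borel"
    unfolding G_def by measurable
  have B_rotate: "B (cis t *s u) = B u" for t u
    by (simp add: B_def indicator_def norm_vector_scalar_mult)
  have rotate: "(\<lambda>x. cis (2 * pi * snd x) *s fst x) \<in> borel_measurable (lborel \<Otimes>\<^sub>M (lborel :: real measure))"
    unfolding lborel_prod measurable_lborel2
    by (intro borel_measurable_continuous_onI)
      (simp add: vector_scalar_mult_def cis_conv_exp continuous_intros)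
  have "ennreal (norm (f z)) * emeasure lborel (ball z \<rho>)
      = (\<integral>\<^sup>+u. ennreal (norm (f z)) * indicator (ball z \<rho>) u \<partial>lborel)"
    by (simp add: nn_integral_cmult_indicator)
  also have "\<dots> = (\<integral>\<^sup>+u. ennreal (norm (f z)) * B u \<partial>lborel)"
    using nn_integral_lborel_translate[of "\<lambda>u. ennreal (norm (f z)) * indicator (ball z \<rho>) u" z]
    by (simp add: indicator_def dist_norm B_def)
  also have "\<dots> \<le> (\<integral>\<^sup>+u. (\<integral>\<^sup>+\<theta>. G (cis (2 * pi * \<theta>) *s u) * indicator {0..1} \<theta> \<partial>lborel) \<partial>lborel)"
  proof (rule nn_integral_mono)
    fix u :: "complex ^ 'n"
    have [measurable]: "(\<lambda>\<theta>. cis (2 * pi * \<theta>) *s u) \<in> borel_measurable borel"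
      by (intro borel_measurable_continuous_onI)
        (simp add: vector_scalar_mult_def cis_conv_exp continuous_intros)
    have "ennreal (norm (f z)) * B u
        \<le> (\<integral>\<^sup>+\<theta>. ennreal (norm (f (z + cis (2 * pi * \<theta>) *s u))) * indicator {0..1} \<theta> \<partial>lborel) * B u"
      using norm_le_circle_mean[OF entire_along_line[OF assms], of z u]
      by (intro mult_right_mono) auto
    also have "\<dots> = (\<integral>\<^sup>+\<theta>. G (cis (2 * pi * \<theta>) *s u) * indicator {0..1} \<theta> \<partial>lborel)"
      by (subst nn_integral_multc[symmetric], measurable)
        (simp add: mult.assoc mult.commute[of "indicator _ _"] G_def B_rotate)
    finally show "ennreal (norm (f z)) * B u
        \<le> (\<integral>\<^sup>+\<theta>. G (cis (2 * pi * \<theta>) *s u) * indicator {0..1} \<theta> \<partial>lborel)" .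
  qed
  also have "\<dots> = (\<integral>\<^sup>+\<theta>. (\<integral>\<^sup>+u. G (cis (2 * pi * \<theta>) *s u) * indicator {0..1} \<theta> \<partial>lborel) \<partial>lborel)"
  proof (rule lborel_pair.Fubini'[symmetric])
    show "(\<lambda>(u, \<theta>). G (cis (2 * pi * \<theta>) *s u) * indicator {0..1} \<theta>)
        \<in> borel_measurable (lborel \<Otimes>\<^sub>M (lborel :: real measure))"
      using measurable_compose[OF rotate G] by (simp add: case_prod_unfold)
  qed
  also have "\<dots> = (\<integral>\<^sup>+\<theta>. (\<integral>\<^sup>+u. G u \<partial>lborel) * indicator {0..1} \<theta> \<partial>(lborel :: real measure))"
  proof (rule nn_integral_cong)
    fix \<theta> :: real
    show "(\<integral>\<^sup>+u. G (cis (2 * pi * \<theta>) *s u) * indicator {0..1} \<theta> \<partial>lborel)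
       = (\<integral>\<^sup>+u. G u \<partial>lborel) * indicator {0..1} \<theta>"
      using nn_integral_lborel_orthogonal[OF orthogonal_transformation_unit_scale,
          of "cis (2 * pi * \<theta>)" "\<lambda>u. G u * indicator {0..1} \<theta>"]
      by (simp add: nn_integral_multc)
  qed
  also have "\<dots> = (\<integral>\<^sup>+u. G u \<partial>lborel)"
    by (simp add: nn_integral_cmult)
  also have "\<dots> = (\<integral>\<^sup>+u. ennreal (norm (f u)) * indicator (ball z \<rho>) u \<partial>lborel)"
    using nn_integral_lborel_translate[of "\<lambda>u. ennreal (norm (f u)) * indicator (ball z \<rho>) u" z]
    by (simp add: indicator_def dist_norm G_def B_def)
  finally show ?thesis .
qed

section \<open>Sub-mean value property for arbitrary positive exponents\<close>

text \<open>
  A sub-mean value property for \<open>u\<close> passes to the powers \<open>u powr s\<close> with \<open>s \<le> 1\<close>, for which Jensen's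
  inequality points the wrong way. Maximise \<open>(r - dist z x) ^ N * u x powr s\<close> over the closed ball,
  where \<open>N\<close> is the dimension; let \<open>M\<close> be the maximum, attained at \<open>x0\<close>, and let \<open>\<rho>\<close> be half the
  distance from \<open>x0\<close> to the boundary. On \<open>ball x0 \<rho>\<close> maximality gives \<open>u y powr s \<le> A\<close> with
  \<open>A = M / \<rho> ^ N\<close>, hence \<open>u y \<le> A powr (1 / s - 1) * u y powr s\<close>. Inserting this into the
  sub-mean value property at \<open>x0\<close>, where \<open>u x0 powr s = A / 2 ^ N\<close>, all powers of \<open>A\<close> but the first
  cancel, and what remains bounds \<open>M\<close> by the integral of \<open>u powr s\<close>.
\<close>

lemma small_exponent_submean:
  fixes u :: "'a::euclidean_space \<Rightarrow> real"
  assumes cont: "continuous_on UNIV u" and nonneg: "\<And>x. u x \<ge> 0"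
    and s: "0 < s" "s \<le> 1" and K: "K > 0" and r: "r > 0"
    and mean: "\<And>x \<rho>. \<rho> > 0 \<Longrightarrow>
      ennreal (u x * \<rho> ^ DIM('a)) \<le> ennreal K * (\<integral>\<^sup>+y. ennreal (u y) * indicator (ball x \<rho>) y \<partial>lborel)"
  shows "ennreal (u z powr s) \<le> ennreal (2 powr (DIM('a) / s) * K / r ^ DIM('a)) *
      (\<integral>\<^sup>+y. ennreal (u y powr s) * indicator (ball z r) y \<partial>lborel)"
proof -
  let ?N = "DIM('a)"
  let ?I = "\<integral>\<^sup>+y. ennreal (u y powr s) * indicator (ball z r) y \<partial>lborel"
  have u_borel [measurable]: "u \<in> borel_measurable borel"
    using cont by (rule borel_measurable_continuous_onI)
  have "continuous_on (cball z r) (\<lambda>x. (r - dist z x) ^ ?N * u x powr s)"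
    using s(1) nonneg
    by (intro continuous_intros continuous_on_subset[OF cont] continuous_on_powr') auto
  from continuous_attains_sup[OF compact_cball _ this] r
  obtain x0 where x0: "x0 \<in> cball z r"
    and max: "\<And>y. y \<in> cball z r \<Longrightarrow> (r - dist z y) ^ ?N * u y powr s \<le> (r - dist z x0) ^ ?N * u x0 powr s"
    by auto
  define M where "M = (r - dist z x0) ^ ?N * u x0 powr s"
  have M_z: "r ^ ?N * u z powr s \<le> M"
    using max[of z] r by (simp add: M_def)
  have "M \<ge> 0" using x0 by (simp add: M_def)
  show ?thesis
  \<comment> \<open>If \<open>M = 0\<close> then \<open>x0\<close> may lie on the boundary and \<open>\<rho>\<close> may be 0; if \<open>M > 0\<close> and the integral is finite, the argument takes place in the reals.\<close>
  proof (cases "M = 0 \<or> ?I = \<infinity>")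
    case True
    then show ?thesis
    proof
      assume "M = 0"
      then have "u z powr s = 0" using M_z r by (simp add: mult_le_0_iff not_le[symmetric] power_le_zero_eq)
      then show ?thesis by simp
    next
      assume "?I = \<infinity>"
      then show ?thesis using K r by (simp add: ennreal_mult_top)
    qed
  next
    case False
    then have "M > 0" and fin: "?I \<noteq> \<infinity>" using \<open>M \<ge> 0\<close> by auto
    define \<rho> where "\<rho> = (r - dist z x0) / 2"
    have "dist z x0 \<noteq> r" using \<open>M > 0\<close> by (auto simp: M_def zero_power)
    with x0 have \<rho>: "\<rho> > 0" by (simp add: \<rho>_def)
    define A where "A = M / \<rho> ^ ?N"
    have A: "A > 0" using \<open>M > 0\<close> \<rho> by (simp add: A_def)
    define J where "J = enn2real ?I"
    have J: "?I = ennreal J" "J \<ge> 0" using fin by (simp_all add: J_def less_top)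
    have near: "u y \<le> A powr (1 / s - 1) * u y powr s" and inside: "y \<in> ball z r" if "y \<in> ball x0 \<rho>" for y
    proof -
      have d: "\<rho> \<le> r - dist z y"
        using that dist_triangle[of z y x0] by (simp add: \<rho>_def dist_commute field_simps)
      then show "y \<in> ball z r" using \<rho> by simp
      have "\<rho> ^ ?N * u y powr s \<le> (r - dist z y) ^ ?N * u y powr s"
        using d \<rho> by (intro mult_right_mono power_mono) auto
      also have "\<dots> \<le> M" unfolding M_def using d \<rho> by (intro max) simp
      finally have le: "u y powr s \<le> A" using \<rho> by (simp add: A_def field_simps)
      have "u y = (u y powr s) powr (1 / s - 1) * u y powr s"
        using s nonneg[of y] by (simp add: powr_powr powr_add[symmetric] field_simps)
      also have "\<dots> \<le> A powr (1 / s - 1) * u y powr s"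
        using le s by (intro mult_right_mono powr_mono2) auto
      finally show "u y \<le> A powr (1 / s - 1) * u y powr s" .
    qed
    have "ennreal (u x0 * \<rho> ^ ?N) \<le> ennreal K * (\<integral>\<^sup>+y. ennreal (u y) * indicator (ball x0 \<rho>) y \<partial>lborel)"
      by (rule mean[OF \<rho>])
    also have "(\<integral>\<^sup>+y. ennreal (u y) * indicator (ball x0 \<rho>) y \<partial>lborel)
        \<le> (\<integral>\<^sup>+y. ennreal (A powr (1 / s - 1)) * (ennreal (u y powr s) * indicator (ball z r) y) \<partial>lborel)"
      using near inside
      by (intro nn_integral_mono) (auto simp: indicator_def ennreal_mult[symmetric] intro!: ennreal_leI)
    also have "\<dots> = ennreal (A powr (1 / s - 1)) * ?I"
      by (rule nn_integral_cmult) simp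
    also have "ennreal K * (ennreal (A powr (1 / s - 1)) * ?I) = ennreal (K * (A powr (1 / s - 1) * J))"
      using K J by (simp add: ennreal_mult)
    finally have "u x0 * \<rho> ^ ?N \<le> K * (A powr (1 / s - 1) * J)"
      using K J by (simp add: mult_left_mono)
    moreover have "u x0 = A powr (1 / s - 1) * (A / 2 powr (?N / s))"
    proof -
      have "u x0 powr s = A / 2 ^ ?N"
        using \<rho> unfolding A_def M_def \<rho>_def by (simp add: power_divide)
      then have "u x0 = (A / 2 ^ ?N) powr (1 / s)"
        using s nonneg[of x0] by (metis nonzero_mult_div_cancel_left powr_one powr_powr less_irrefl mult.right_neutral times_divide_eq_right)
      also have "\<dots> = A powr (1 / s) / 2 powr (?N / s)"
        using A by (simp add: powr_divide powr_realpow[symmetric] powr_powr)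
      also have "A powr (1 / s) = A powr (1 / s - 1) * A"
        using A by (simp add: powr_diff)
      finally show ?thesis by simp
    qed
    ultimately have "A powr (1 / s - 1) * (A / 2 powr (?N / s) * \<rho> ^ ?N) \<le> A powr (1 / s - 1) * (K * J)"
      by (simp add: mult_ac)
    then have "A / 2 powr (?N / s) * \<rho> ^ ?N \<le> K * J"
      by (rule mult_left_le_imp_le) (use A in simp)
    then have "M \<le> 2 powr (?N / s) * K * J"
      using \<rho> by (simp add: A_def field_simps)
    with M_z have "u z powr s \<le> 2 powr (?N / s) * K / r ^ ?N * J"
      using r by (simp add: field_simps)
    then show ?thesis
      using J K r by (simp add: ennreal_mult[symmetric])
  qed
qed

lemma entire_mult:
  assumes "entire f" "entire g"
  shows "entire (\<lambda>z. f z * g z)"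
  unfolding entire_def
proof
  fix z
  obtain L where L: "(f has_derivative L) (at z)" "\<And>c v. L (c *s v) = c * L v"
    using assms(1) unfolding entire_def by blast
  obtain M where M: "(g has_derivative M) (at z)" "\<And>c v. M (c *s v) = c * M v"
    using assms(2) unfolding entire_def by blast
  show "\<exists>L. ((\<lambda>z. f z * g z) has_derivative L) (at z) \<and> (\<forall>c v. L (c *s v) = c * L v)"
    using has_derivative_mult[OF L(1) M(1)] L(2) M(2)
    by (intro exI conjI) (auto simp: algebra_simps)
qed

lemma entire_const: "entire (\<lambda>_. c)"
  unfolding entire_def by (intro allI exI[of _ "\<lambda>_. 0"]) simp

lemma entire_power: "entire f \<Longrightarrow> entire (\<lambda>z. f z ^ k)"
  by (induction k) (simp_all add: entire_const entire_mult)

text \<open>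
  The Hermitian product, linear in the first argument. Its real part is the inner product of the
  underlying real Euclidean space.
\<close>

definition cinner :: "complex ^ 'n \<Rightarrow> complex ^ 'n \<Rightarrow> complex" where
  "cinner z w = (\<Sum>i\<in>UNIV. z $ i * cnj (w $ i))"

lemma Re_cinner: "Re (cinner z w) = z \<bullet> w"
  by (simp add: cinner_def inner_vec_def inner_complex_def)

lemma cinner_scale: "cinner (c *s z) w = c * cinner z w"
  by (simp add: cinner_def sum_distrib_left mult.assoc)

lemma cinner_add: "cinner (y + z) w = cinner y w + cinner z w"
  by (simp add: cinner_def sum.distrib distrib_right)

lemma bounded_linear_cinner: "bounded_linear (\<lambda>z. cinner z w)"
proof (rule linear_conv_bounded_linear[THEN iffD1], rule linearI)
  show "cinner (r *\<^sub>R z) w = r *\<^sub>R cinner z w" for r z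
    using cinner_scale[of "of_real r" z w] by (simp add: scaleR_conv_of_real vector_scalar_mult_def scaleR_vec_def)
qed (rule cinner_add)

lemma entire_exp_cinner: "entire (\<lambda>z. exp (a * cinner z w))"
  unfolding entire_def
proof
  fix z
  have "((\<lambda>z. exp (a * cinner z w)) has_derivative (\<lambda>h. exp (a * cinner z w) * (a * cinner h w))) (at z)"
  proof -
    have "((\<lambda>z. a * cinner z w) has_derivative (\<lambda>h. a * cinner h w)) (at z)"
      by (intro has_derivative_mult_right bounded_linear_imp_has_derivative bounded_linear_cinner)
    from has_derivative_compose[OF this, of exp] show ?thesis
      using DERIV_exp[of "a * cinner z w"] by (simp add: has_field_derivative_def)
  qed
  then show "\<exists>L. ((\<lambda>z. exp (a * cinner z w)) has_derivative L) (at z) \<and> (\<forall>c v. L (c *s v) = c * L v)"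
    by (intro exI conjI) (auto simp: cinner_scale)
qed

text \<open>
  For an integer \<open>k \<ge> p\<close> the function \<open>f ^ k\<close> is entire, so that \<open>norm f ^ k\<close> has the sub-mean value
  property; \<open>norm f powr p\<close> is its power with exponent \<open>p / k \<le> 1\<close>.
\<close>

lemma entire_powr_submean:
  assumes p: "p > 0" and r: "r > 0"
  obtains C where "C > 0"
    "\<And>(f :: complex ^ 'n \<Rightarrow> complex) z. entire f \<Longrightarrow> ennreal (norm (f z) powr p)
       \<le> ennreal C * (\<integral>\<^sup>+u. ennreal (norm (f u) powr p) * indicator (ball z r) u \<partial>lborel)"
proof
  let ?N = "DIM(complex ^ 'n)"
  define k where "k = nat \<lceil>p\<rceil>"
  have k: "k \<ge> 1" "p \<le> k" using p by (simp_all add: k_def) linarith+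
  define s where "s = p / k"
  have s: "0 < s" "s \<le> 1" using k p by (simp_all add: s_def)
  define V where "V = unit_ball_vol ?N"
  have V: "V > 0" unfolding V_def by (rule unit_ball_vol_pos) simp
  define C where "C = 2 powr (?N / s) * (1 / V) / r ^ ?N"
  show "C > 0" using r V by (simp add: C_def)
  fix f :: "complex ^ 'n \<Rightarrow> complex" and z
  assume f: "entire f"
  have fk: "entire (\<lambda>z. f z ^ k)" using f by (rule entire_power)
  have pow: "(norm (f u) ^ k) powr s = norm (f u) powr p" for u
    using k by (cases "f u = 0") (simp_all add: powr_realpow[symmetric] powr_powr s_def)
  have "ennreal ((norm (f z) ^ k) powr s) \<le> ennreal C *
     (\<integral>\<^sup>+u. ennreal ((norm (f u) ^ k) powr s) * indicator (ball z r) u \<partial>lborel)"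
    unfolding C_def
  proof (rule small_exponent_submean)
    show "continuous_on UNIV (\<lambda>x. norm (f x) ^ k)"
      using entire_continuous_on[OF f] by (intro continuous_intros)
    fix x \<rho> :: _
    show "ennreal (norm (f x) ^ k * \<rho> ^ ?N)
        \<le> ennreal (1 / V) * (\<integral>\<^sup>+y. ennreal (norm (f y) ^ k) * indicator (ball x \<rho>) y \<partial>lborel)"
      if "\<rho> > 0"
    proof -
      have \<rho>: "\<rho> > 0" by fact
      have vol: "emeasure lborel (ball x \<rho>) = ennreal (V * \<rho> ^ ?N)"
        unfolding V_def using \<rho> by (intro emeasure_ball) simp
      have "ennreal (norm (f x) ^ k * \<rho> ^ ?N)
          = ennreal (1 / V) * (ennreal (norm (f x ^ k)) * emeasure lborel (ball x \<rho>))"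
        using V \<rho> unfolding vol by (simp add: norm_power flip: ennreal_mult)
      also have "\<dots> \<le> ennreal (1 / V) * (\<integral>\<^sup>+y. ennreal (norm (f y) ^ k) * indicator (ball x \<rho>) y \<partial>lborel)"
        using entire_ball_mean[OF fk, of x \<rho>] by (intro mult_left_mono) (simp_all add: norm_power)
      finally show ?thesis .
    qed
  qed (use s r V in auto)
  then show "ennreal (norm (f z) powr p)
       \<le> ennreal C * (\<integral>\<^sup>+u. ennreal (norm (f u) powr p) * indicator (ball z r) u \<partial>lborel)"
    by (simp add: pow)
qed

section \<open>Sub-mean value property with the Fock weight\<close>

text \<open>
  The Gaussian is attached to \<open>f\<close> before any power is taken: all the integrands below are then powers
  of this one function, whatever the exponent.
\<close>

definition fock_weighted :: "real \<Rightarrow> (complex ^ 'n \<Rightarrow> complex) \<Rightarrow> complex ^ 'n \<Rightarrow> real" where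
  "fock_weighted \<alpha> f z = norm (f z) * exp (- (\<alpha> / 2) * (norm z)\<^sup>2)"

lemma fock_weighted_nonneg: "fock_weighted \<alpha> f z \<ge> 0"
  by (simp add: fock_weighted_def)

lemma fock_weighted_borel_measurable: "entire f \<Longrightarrow> fock_weighted \<alpha> f \<in> borel_measurable borel"
  unfolding fock_weighted_def using entire_borel_measurable[of f] by measurable

lemma fock_weighted_powr:
  "fock_weighted \<alpha> f z powr p = norm (f z) powr p * exp (- (\<alpha> * p / 2) * (norm z)\<^sup>2)"
  by (simp add: fock_weighted_def powr_mult exp_powr_real mult_ac)

text \<open>
  The Gaussian weight is not harmless on balls of fixed radius far from the origin, but it can be
  centred: with \<open>g u = f u * exp (- \<alpha> * cinner u z)\<close> one has
  \<open>fock_weighted \<alpha> f u = norm (g u) * exp (\<alpha> / 2 * (norm z)\<^sup>2) * exp (- \<alpha> / 2 * (norm (u - z))\<^sup>2)\<close>,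
  and the last factor lies between two positive constants on \<open>ball z r\<close>. So the unweighted estimate
  for the entire function \<open>g\<close> gives a constant independent of \<open>z\<close>.
\<close>

lemma fock_weighted_submean:
  fixes \<alpha> :: real
  assumes p: "p > 0" and r: "r > 0" and \<alpha>: "\<alpha> > 0"
  obtains C where "C > 0"
    "\<And>(f :: complex ^ 'n \<Rightarrow> complex) z. entire f \<Longrightarrow> ennreal (fock_weighted \<alpha> f z powr p)
       \<le> ennreal C * (\<integral>\<^sup>+u. ennreal (fock_weighted \<alpha> f u powr p) * indicator (ball z r) u \<partial>lborel)"
proof -
  obtain C where C: "C > 0" and submean:
    "\<And>(f :: complex ^ 'n \<Rightarrow> complex) z. entire f \<Longrightarrow> ennreal (norm (f z) powr p)
       \<le> ennreal C * (\<integral>\<^sup>+u. ennreal (norm (f u) powr p) * indicator (ball z r) u \<partial>lborel)"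
    using entire_powr_submean[OF p r] by blast
  define D where "D = exp (\<alpha> / 2 * r\<^sup>2) powr p"
  have D: "D > 0" by (simp add: D_def)
  show ?thesis
  proof (rule that[of "C * D"])
    show "C * D > 0" using C D by simp
    fix f :: "complex ^ 'n \<Rightarrow> complex" and z
    assume f: "entire f"
    let ?F = "fock_weighted \<alpha> f"
    define g where "g u = f u * exp (- of_real \<alpha> * cinner u z)" for u
    define E where "E = exp (\<alpha> / 2 * (norm z)\<^sup>2) powr p"
    have E: "E > 0" by (simp add: E_def)
    have g: "entire g"
      unfolding g_def by (intro entire_mult f entire_exp_cinner)
    have [measurable]: "?F \<in> borel_measurable borel"
      using f by (rule fock_weighted_borel_measurable)
    have F_g: "norm (g u) * exp (\<alpha> / 2 * (norm z)\<^sup>2) = ?F u * exp (\<alpha> / 2 * (norm (u - z))\<^sup>2)" for u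
    proof -
      have "\<alpha> / 2 * (norm z)\<^sup>2 - \<alpha> * (u \<bullet> z) = \<alpha> / 2 * (norm (u - z))\<^sup>2 - \<alpha> / 2 * (norm u)\<^sup>2"
        by (simp add: power2_norm_eq_inner inner_diff_left inner_diff_right inner_commute algebra_simps)
      then show ?thesis
        by (simp add: g_def fock_weighted_def norm_mult Re_cinner mult.assoc flip: exp_add)
    qed
    have F_g': "ennreal E * ennreal (norm (g u) powr p) = ennreal ((?F u * exp (\<alpha> / 2 * (norm (u - z))\<^sup>2)) powr p)" for u
    proof -
      have "E * norm (g u) powr p = (norm (g u) * exp (\<alpha> / 2 * (norm z)\<^sup>2)) powr p"
        by (simp add: E_def powr_mult mult.commute)
      then show ?thesis using E unfolding F_g by (simp flip: ennreal_mult)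
    qed
    have "ennreal (?F z powr p) = ennreal E * ennreal (norm (g z) powr p)"
      by (simp add: F_g')
    also have "\<dots> \<le> ennreal E * (ennreal C * (\<integral>\<^sup>+u. ennreal (norm (g u) powr p) * indicator (ball z r) u \<partial>lborel))"
      by (intro mult_left_mono submean g) simp
    also have "\<dots> = ennreal C * (\<integral>\<^sup>+u. ennreal E * ennreal (norm (g u) powr p) * indicator (ball z r) u \<partial>lborel)"
    proof -
      have [measurable]: "g \<in> borel_measurable borel" using g by (rule entire_borel_measurable)
      show ?thesis
        unfolding mult.assoc by (subst nn_integral_cmult) (simp_all add: mult.left_commute)
    qed
    also have "\<dots> \<le> ennreal C * (\<integral>\<^sup>+u. ennreal D * (ennreal (?F u powr p) * indicator (ball z r) u) \<partial>lborel)"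
    proof (intro mult_left_mono nn_integral_mono)
      fix u
      show "ennreal E * ennreal (norm (g u) powr p) * indicator (ball z r) u
          \<le> ennreal D * (ennreal (?F u powr p) * indicator (ball z r) u)"
      proof (cases "u \<in> ball z r")
        case True
        then have "(norm (u - z))\<^sup>2 \<le> r\<^sup>2"
          by (simp add: dist_norm norm_minus_commute power_mono)
        then have "(?F u * exp (\<alpha> / 2 * (norm (u - z))\<^sup>2)) powr p \<le> (?F u * exp (\<alpha> / 2 * r\<^sup>2)) powr p"
          using \<alpha> p by (intro powr_mono2 mult_left_mono) (auto simp: fock_weighted_nonneg)
        also have "\<dots> = D * ?F u powr p"
          by (simp add: D_def powr_mult fock_weighted_nonneg mult.commute)
        finally show ?thesis
          using True D unfolding F_g' by (simp add: ennreal_mult[symmetric])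
      qed simp
    qed simp
    also have "\<dots> = ennreal (C * D) * (\<integral>\<^sup>+u. ennreal (?F u powr p) * indicator (ball z r) u \<partial>lborel)"
      using C D by (subst nn_integral_cmult) (auto simp: ennreal_mult mult.assoc)
    finally show "ennreal (?F z powr p)
       \<le> ennreal (C * D) * (\<integral>\<^sup>+u. ennreal (?F u powr p) * indicator (ball z r) u \<partial>lborel)" .
  qed
qed

section \<open>Limits at infinity and lattices\<close>

lemma ennreal_tendsto_0_iff:
  "(X \<longlongrightarrow> (0::ennreal)) F \<longleftrightarrow> (\<forall>\<epsilon>>0. eventually (\<lambda>x. X x \<le> ennreal \<epsilon>) F)"
proof
  assume "(X \<longlongrightarrow> 0) F"
  then show "\<forall>\<epsilon>>0. eventually (\<lambda>x. X x \<le> ennreal \<epsilon>) F"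
    by (auto dest!: order_tendstoD(2) elim: eventually_mono intro: less_imp_le)
next
  assume *: "\<forall>\<epsilon>>0. eventually (\<lambda>x. X x \<le> ennreal \<epsilon>) F"
  show "(X \<longlongrightarrow> 0) F"
  proof (rule order_tendstoI)
    fix a :: ennreal assume "0 < a"
    then obtain b where b: "0 < b" "b < a" using dense by blast
    then have "b < top" by (meson less_le_trans top_greatest)
    with b have "b = ennreal (enn2real b)" "enn2real b > 0"
      by (auto simp: enn2real_positive_iff less_top[symmetric])
    with * have "eventually (\<lambda>x. X x \<le> b) F" by metis
    then show "eventually (\<lambda>x. X x < a) F"
      by (rule eventually_mono) (use b in auto)
  qed simp
qed

text \<open>
  Vanishing Carleson measures are tested on sequences, whereas the other conditions speak of the
  filter at infinity; this passes from the former to the latter.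
\<close>

lemma tendsto_at_infinity_sequentially:
  fixes X :: "'a::real_normed_vector \<Rightarrow> 'b::topological_space"
  assumes "\<And>w. filterlim w at_infinity sequentially \<Longrightarrow> (\<lambda>j. X (w j)) \<longlonglongrightarrow> l"
  shows "(X \<longlongrightarrow> l) at_infinity"
proof (rule topological_tendstoI, rule ccontr)
  fix S assume S: "open S" "l \<in> S" and neg: "\<not> eventually (\<lambda>x. X x \<in> S) at_infinity"
  have "\<exists>x. norm x \<ge> real j \<and> X x \<notin> S" for j
    using neg unfolding eventually_at_infinity by auto
  then obtain w where w: "\<And>j. norm (w j) \<ge> real j" "\<And>j. X (w j) \<notin> S" by metis
  have "filterlim w at_infinity sequentially"
    unfolding filterlim_at_infinity_conv_norm_at_top
    by (rule filterlim_at_top_mono[OF filterlim_real_sequentially]) (use w(1) in auto)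
  from topological_tendstoD[OF assms[OF this] S] w(2) show False
    by (simp add: eventually_sequentially)
qed

text \<open>
  The centres are separated by a fixed distance, so that a bounded set contains finitely many.
\<close>

lemma half_lattice_at_infinity:
  assumes z: "half_lattice r z" and r: "r > 0"
  shows "filterlim z at_infinity sequentially"
  unfolding filterlim_at_infinity_conv_norm_at_top filterlim_at_top
proof
  fix R :: real
  let ?K = "{k. \<not> R \<le> norm (z k)}"
  have far: "dist (z j) (z k) \<ge> r / 2" if "j \<noteq> k" for j k
  proof (rule ccontr)
    assume "\<not> ?thesis"
    then have "z k \<in> ball (z j) (r / 2) \<inter> ball (z k) (r / 2)" using r by simp
    with that z show False unfolding half_lattice_def disjoint_family_on_def by blast
  qed
  have "uniform_discrete (z ` ?K)"
    unfolding uniform_discrete_def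
  proof (intro exI[of _ "r / 2"] conjI ballI impI)
    fix x y assume "x \<in> z ` ?K" "y \<in> z ` ?K" and xy: "dist x y < r / 2"
    then obtain j k where "x = z j" "y = z k" by blast
    with far[of j k] xy show "x = y" by (cases "j = k") auto
  qed (use r in simp)
  moreover have "bounded (z ` ?K)"
    by (auto simp: bounded_iff intro!: exI[of _ R])
  ultimately have "finite (z ` ?K)" using uniform_discrete_finite_iff by blast
  then have "finite ?K"
    using z by (auto simp: half_lattice_def intro: finite_imageD inj_on_subset)
  then show "eventually (\<lambda>k. R \<le> norm (z k)) sequentially"
    by (simp add: cofinite_eq_sequentially[symmetric] eventually_cofinite)
qed

text \<open>
  A maximal set of points with mutual distances at least \<open>r\<close> is a lattice: a point at distance at least
  \<open>r\<close> from all of them could be added. It is countable because the space is separable, and infinite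
  because finitely many balls do not cover the space.
\<close>

lemma half_lattice_exists:
  assumes r: "r > 0"
  shows "\<exists>z :: nat \<Rightarrow> complex ^ 'n. half_lattice r z"
proof -
  define sep where "sep = {S :: (complex ^ 'n) set. \<forall>x\<in>S. \<forall>y\<in>S. x \<noteq> y \<longrightarrow> r \<le> dist x y}"
  obtain S where S: "S \<in> sep" and max: "\<And>T. T \<in> sep \<Longrightarrow> S \<subseteq> T \<Longrightarrow> T = S"
  proof -
    have chain: "\<exists>U\<in>sep. \<forall>X\<in>\<C>. X \<subseteq> U" if "subset.chain sep \<C>" for \<C>
    proof (intro bexI ballI)
      show "\<Union>\<C> \<in> sep"
        unfolding sep_def
      proof (intro CollectI ballI impI)
        fix x y assume xy: "x \<in> \<Union>\<C>" "y \<in> \<Union>\<C>" "x \<noteq> y"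
        then obtain X Y where "X \<in> \<C>" "x \<in> X" "Y \<in> \<C>" "y \<in> Y" by blast
        moreover from this have "X \<subseteq> Y \<or> Y \<subseteq> X" "X \<in> sep" "Y \<in> sep"
          using that unfolding subset_chain_def by blast+
        ultimately show "r \<le> dist x y" using xy(3) unfolding sep_def by blast
      qed
    qed auto
    from subset_Zorn[OF chain] that show ?thesis by blast
  qed
  have sepD: "r \<le> dist x y" if "x \<in> S" "y \<in> S" "x \<noteq> y" for x y
    using S that by (auto simp: sep_def)
  have cover: "\<exists>x\<in>S. dist x y < r" for y
  proof (rule ccontr)
    assume "\<not> ?thesis"
    then have "insert y S \<in> sep" and "y \<notin> S"
      using S r by (auto simp: sep_def not_less dist_commute)
    with max[of "insert y S"] show False by blast
  qed
  have disj: "ball x (r / 2) \<inter> ball y (r / 2) = {}" if "x \<in> S" "y \<in> S" "x \<noteq> y" for x y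
    using sepD[OF that] by (intro disjoint_ballI) simp
  have "countable S"
  proof -
    have "inj_on (\<lambda>x. ball x (r / 2)) S"
      using disj r by (force simp: inj_on_def)
    moreover have "countable ((\<lambda>x. ball x (r / 2)) ` S)"
      by (rule countable_disjoint_open_subsets) (use disj in \<open>auto simp: pairwise_def disjnt_def\<close>)
    ultimately show ?thesis by (metis countable_image_inj_on)
  qed
  moreover have "infinite S"
  proof
    assume "finite S"
    then have "bounded (\<Union>x\<in>S. ball x r)" by auto
    moreover have "(\<Union>x\<in>S. ball x r) = UNIV" using cover by auto
    ultimately show False using not_bounded_UNIV[where 'a = "complex ^ 'n"] by simp
  qed
  ultimately have bij: "bij_betw (from_nat_into S) UNIV S"
    by (rule bij_betw_from_nat_into)
  let ?z = "from_nat_into S"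
  have "half_lattice r ?z"
    unfolding half_lattice_def disjoint_family_on_def
  proof (intro conjI ballI impI)
    show "inj ?z" using bij by (rule bij_betw_imp_inj_on)
    show "(\<Union>k. ball (?z k) r) = UNIV"
    proof (rule UNIV_eq_I[symmetric])
      fix y
      from cover[of y] obtain x where "x \<in> S" "dist x y < r" by blast
      moreover from this obtain k where "x = ?z k"
        using bij_betw_imp_surj_on[OF bij] by blast
      ultimately show "y \<in> (\<Union>k. ball (?z k) r)" by auto
    qed
    fix j k :: nat assume "j \<noteq> k"
    with bij have "?z j \<in> S" "?z k \<in> S" "?z j \<noteq> ?z k"
      by (auto simp: bij_betw_def inj_eq)
    then show "ball (?z j) (r / 2) \<inter> ball (?z k) (r / 2) = {}" by (rule disj)
  qed
  then show ?thesis by blast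
qed

text \<open>
  If \<open>v \<in> ball (z k) R\<close>, then \<open>ball (z k) (r / 2)\<close> lies in a ball of fixed radius around \<open>v\<close>. These small
  balls are disjoint and of equal volume, so comparing volumes bounds their number.
\<close>

lemma half_lattice_overlap:
  fixes z :: "nat \<Rightarrow> complex ^ 'n"
  assumes z: "half_lattice r z" and r: "r > 0"
  obtains B :: real where "B > 0" "\<And>v. (\<Sum>k. indicator (ball (z k) R) v) \<le> ennreal B"
proof -
  let ?vol = "\<lambda>x \<rho>. emeasure lborel (ball (x :: complex ^ 'n) \<rho>)"
  define c where "c = enn2real (?vol 0 (r / 2))"
  \<comment> \<open>The absolute value only caters for negative \<open>R\<close>, where the balls are empty.\<close>
  define D where "D = enn2real (?vol 0 (\<bar>R\<bar> + r / 2))"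
  have vol_eq: "?vol x \<rho> = ?vol 0 \<rho>" if "\<rho> > 0" for x \<rho>
    using that by (simp add: emeasure_ball)
  have c: "?vol 0 (r / 2) = ennreal c" "c > 0"
    using emeasure_lborel_ball_finite[of "0 :: complex ^ 'n" "r / 2"]
      emeasure_lborel_ball_nonzero[of "r / 2" "0 :: complex ^ 'n"] r
    by (auto simp: c_def enn2real_positive_iff less_top[symmetric] zero_less_iff_neq_zero)
  have D: "?vol 0 (\<bar>R\<bar> + r / 2) = ennreal D" "D > 0"
    using emeasure_lborel_ball_finite[of "0 :: complex ^ 'n" "\<bar>R\<bar> + r / 2"]
      emeasure_lborel_ball_nonzero[of "\<bar>R\<bar> + r / 2" "0 :: complex ^ 'n"] r
    by (auto simp: D_def enn2real_positive_iff less_top[symmetric] zero_less_iff_neq_zero)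
  show ?thesis
  proof (rule that[of "D / c"])
    show "D / c > 0" using c D by simp
    fix v
    define A where "A k = (if v \<in> ball (z k) R then ball (z k) (r / 2) else {})" for k
    have disj: "disjoint_family A"
      using z unfolding half_lattice_def disjoint_family_on_def A_def by auto
    have "(\<Sum>k. indicator (ball (z k) R) v) * ennreal c = (\<Sum>k. indicator (ball (z k) R) v * ennreal c)"
      by (rule ennreal_suminf_multc[symmetric])
    also have "\<dots> = (\<Sum>k. emeasure lborel (A k))"
      using vol_eq[of "r / 2"] r c by (intro suminf_cong) (simp add: A_def indicator_def)
    also have "\<dots> = emeasure lborel (\<Union>k. A k)"
      by (rule suminf_emeasure[OF _ disj]) (auto simp: A_def)
    also have "\<dots> \<le> ?vol v (\<bar>R\<bar> + r / 2)"
    proof (rule emeasure_mono)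
      show "(\<Union>k. A k) \<subseteq> ball v (\<bar>R\<bar> + r / 2)"
      proof
        fix x assume "x \<in> (\<Union>k. A k)"
        then obtain k where "dist (z k) v < R" "dist (z k) x < r / 2"
          by (auto simp: A_def split: if_splits)
        then show "x \<in> ball v (\<bar>R\<bar> + r / 2)"
          using dist_triangle[of v x "z k"] by (simp add: dist_commute)
      qed
    qed simp
    also have "\<dots> = ennreal D" using r D(1) by (subst vol_eq) auto
    finally have "(\<Sum>k. indicator (ball (z k) R) v) * ennreal c / ennreal c \<le> ennreal D / ennreal c"
      by (rule divide_right_mono_ennreal)
    then show "(\<Sum>k. indicator (ball (z k) R) v) \<le> ennreal (D / c)"
      using c(2) D(2) by (simp add: divide_ennreal ennreal_mult_divide_eq)
  qed
qed

section \<open>Integrals along bounded sequences tending to zero\<close>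

lemma positive_borel_measure_measurable:
  assumes "positive_borel_measure \<mu>" "g \<in> borel_measurable borel"
  shows "g \<in> borel_measurable \<mu>"
  using assms measurable_cong_sets[of \<mu> borel] unfolding positive_borel_measure_def by blast

text \<open>
  The core of the theorem. Let \<open>F = fock_weighted \<alpha> (f j)\<close>, let \<open>\<tau> = s * p / q\<close> and let \<open>I k\<close> be the
  integral of \<open>(1 + norm v) powr \<tau> * F v powr p\<close> over \<open>ball (z k) (2 * r)\<close>. By the sub-mean value
  property, \<open>(1 + norm (z k)) powr \<tau> * F u powr p\<close> is at most a multiple of \<open>I k\<close> on \<open>ball (z k) r\<close>;
  raising this to the power \<open>q / p \<ge> 1\<close> and using that \<open>I k\<close> is bounded keeps the bound linear in \<open>I k\<close>.
  Hence the \<open>\<mu>\<close>-integral of \<open>F powr q\<close> over \<open>ball (z k) r\<close> is at most a multiple of the averaging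
  function at \<open>z k\<close> times \<open>I k\<close>, and the \<open>I k\<close> have a bounded sum because the doubled balls overlap
  boundedly often. So the balls with large \<open>k\<close> contribute little uniformly in \<open>j\<close>. The finitely many
  others lie in a compact set, of finite \<open>\<mu>\<close>-measure, on which \<open>f j\<close> tends to 0 uniformly.

  The exponent \<open>s\<close> is not tied to \<open>q\<close> here: with \<open>s = m * q\<close> the lemma proves the Carleson property,
  and with other exponents \<open>p = q\<close> it controls the Berezin type transforms.
\<close>

lemma carleson_sequence_tendsto_0:
  fixes f :: "nat \<Rightarrow> complex ^ 'n \<Rightarrow> complex" and z :: "nat \<Rightarrow> complex ^ 'n"
  assumes \<alpha>: "\<alpha> > 0" and p: "0 < p" "p \<le> q" and s: "s \<ge> 0"
    and \<mu>: "positive_borel_measure \<mu>"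
    and r: "r > 0" and z: "half_lattice r z"
    and avg: "(\<lambda>k. averaging_function s r \<mu> (z k)) \<longlonglongrightarrow> 0"
    and f: "\<And>j. entire (f j)"
    and bounded: "\<forall>\<^sub>F j in sequentially.
      (\<integral>\<^sup>+u. ennreal ((1 + norm u) powr (s * p / q) * fock_weighted \<alpha> (f j) u powr p) \<partial>lborel) \<le> ennreal M"
    and unif: "\<And>R. uniform_limit (cball 0 R) f (\<lambda>_. 0) sequentially"
  shows "(\<lambda>j. \<integral>\<^sup>+u. ennreal (fock_weighted \<alpha> (f j) u powr q) \<partial>\<mu>) \<longlonglongrightarrow> 0"
proof -
  have q: "q > 0" using p by simp
  define \<tau> where "\<tau> = s * p / q"
  have \<tau>: "\<tau> \<ge> 0" using s p q by (simp add: \<tau>_def)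
  have sets: "sets \<mu> = sets borel" using \<mu> by (simp add: positive_borel_measure_def)
  have meas: "g \<in> borel_measurable \<mu>" if "g \<in> borel_measurable borel" for g :: "complex ^ 'n \<Rightarrow> ennreal"
    using \<mu> that by (rule positive_borel_measure_measurable)
  have ball_\<mu>: "ball x \<rho> \<in> sets \<mu>" "cball x \<rho> \<in> sets \<mu>" for x \<rho>
    using sets by simp_all
  let ?F = "\<lambda>j. fock_weighted \<alpha> (f j)"
  have F [measurable]: "?F j \<in> borel_measurable borel" for j
    using f by (rule fock_weighted_borel_measurable)
  obtain C where C: "C > 0" and submean:
    "\<And>(g :: complex ^ 'n \<Rightarrow> complex) x. entire g \<Longrightarrow> ennreal (fock_weighted \<alpha> g x powr p)
       \<le> ennreal C * (\<integral>\<^sup>+u. ennreal (fock_weighted \<alpha> g u powr p) * indicator (ball x r) u \<partial>lborel)"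
    using fock_weighted_submean[OF p(1) r \<alpha>] by blast
  obtain B where B: "B > 0" and overlap: "\<And>v. (\<Sum>k. indicator (ball (z k) (2 * r)) v) \<le> ennreal B"
    using half_lattice_overlap[OF z r] by blast
  define M' where "M' = max M 0"
  have M': "M' \<ge> 0" by (simp add: M'_def)
  define D where "D = C * (1 + 2 * r) powr \<tau>"
  have D: "D > 0" using C r by (simp add: D_def)
  define L where "L = (D * M') powr (q / p - 1) * D"
  have L: "L \<ge> 0" using D by (simp add: L_def)
  define G where "G j v = (1 + norm v) powr \<tau> * ?F j v powr p" for j v
  have G [measurable]: "G j \<in> borel_measurable borel" for j
    unfolding G_def by measurable
  define I where "I j k = (\<integral>\<^sup>+v. ennreal (G j v) * indicator (ball (z k) (2 * r)) v \<partial>lborel)" for j k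
  define good where "good j \<longleftrightarrow> (\<integral>\<^sup>+u. ennreal (G j u) \<partial>lborel) \<le> ennreal M'" for j
  have ev_good: "eventually good sequentially"
    using bounded by (rule eventually_mono) (auto simp: good_def G_def \<tau>_def M'_def elim: order_trans intro!: ennreal_leI)
  have I_le: "I j k \<le> ennreal M'" if "good j" for j k
  proof -
    have "I j k \<le> (\<integral>\<^sup>+v. ennreal (G j v) \<partial>lborel)"
      unfolding I_def by (intro nn_integral_mono) (simp add: indicator_def)
    with that show ?thesis by (simp add: good_def)
  qed
  have pointwise: "ennreal ((1 + norm (z k)) powr s * ?F j u powr q) \<le> ennreal L * I j k"
    if "good j" and u: "u \<in> ball (z k) r" for j k u
  proof -
    define X where "X = (1 + norm (z k)) powr \<tau> * ?F j u powr p"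
    have X_nonneg: "X \<ge> 0" by (simp add: X_def)
    have "ennreal X = ennreal ((1 + norm (z k)) powr \<tau>) * ennreal (?F j u powr p)"
      by (simp add: X_def ennreal_mult)
    also have "\<dots> \<le> ennreal ((1 + norm (z k)) powr \<tau>) *
        (ennreal C * (\<integral>\<^sup>+v. ennreal (?F j v powr p) * indicator (ball u r) v \<partial>lborel))"
      by (intro mult_left_mono submean f) simp
    also have "\<dots> = ennreal C * (\<integral>\<^sup>+v. ennreal ((1 + norm (z k)) powr \<tau>) *
        (ennreal (?F j v powr p) * indicator (ball u r) v) \<partial>lborel)"
      by (subst nn_integral_cmult) (simp_all add: mult.left_commute)
    also have "\<dots> \<le> ennreal C * (\<integral>\<^sup>+v. ennreal ((1 + 2 * r) powr \<tau>) *
        (ennreal (G j v) * indicator (ball (z k) (2 * r)) v) \<partial>lborel)"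
    proof (intro mult_left_mono nn_integral_mono)
      fix v
      show "ennreal ((1 + norm (z k)) powr \<tau>) * (ennreal (?F j v powr p) * indicator (ball u r) v)
        \<le> ennreal ((1 + 2 * r) powr \<tau>) * (ennreal (G j v) * indicator (ball (z k) (2 * r)) v)"
      proof (cases "v \<in> ball u r")
        case True
        with u have d: "dist (z k) v < 2 * r"
          using dist_triangle[of "z k" v u] by simp
        then have "norm (z k) \<le> norm v + 2 * r"
          using norm_triangle_ineq2[of "z k" v] by (simp add: dist_norm)
        moreover have "0 \<le> 2 * r * norm v" using r by simp
        ultimately have "1 + norm (z k) \<le> (1 + 2 * r) * (1 + norm v)"
          by (simp add: algebra_simps)
        then have "(1 + norm (z k)) powr \<tau> \<le> (1 + 2 * r) powr \<tau> * (1 + norm v) powr \<tau>"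
          using r \<tau> powr_mono2[of \<tau> "1 + norm (z k)" "(1 + 2 * r) * (1 + norm v)"]
          by (simp add: powr_mult)
        then have "(1 + norm (z k)) powr \<tau> * ?F j v powr p \<le> (1 + 2 * r) powr \<tau> * G j v"
          unfolding G_def mult.assoc[symmetric] by (intro mult_right_mono) simp_all
        then show ?thesis
          using True d by (simp add: G_def ennreal_leI flip: ennreal_mult)
      qed simp
    qed simp
    also have "\<dots> = ennreal D * I j k"
      using C unfolding I_def D_def by (subst nn_integral_cmult) (simp_all add: ennreal_mult mult.assoc)
    finally have X_I: "ennreal X \<le> ennreal D * I j k" .
    also have "\<dots> \<le> ennreal (D * M')"
      using I_le[OF that(1), of k] D M' by (simp add: ennreal_mult mult_left_mono)
    finally have X_M: "X \<le> D * M'" using D M' by simp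
    have "(1 + norm (z k)) powr s * ?F j u powr q = X powr (q / p)"
      using p q by (simp add: X_def powr_mult powr_powr \<tau>_def)
    \<comment> \<open>One factor \<open>X\<close> is kept, for the summation over \<open>k\<close>; the others are bounded by a constant.\<close>
    also have "\<dots> = X powr (q / p - 1) * X"
      using X_nonneg p by (cases "X = 0") (simp_all add: powr_diff)
    also have "\<dots> \<le> (D * M') powr (q / p - 1) * X"
      using X_M X_nonneg p by (intro mult_right_mono powr_mono2) auto
    finally have "ennreal ((1 + norm (z k)) powr s * ?F j u powr q)
        \<le> ennreal ((D * M') powr (q / p - 1)) * ennreal X"
      using X_nonneg by (simp add: ennreal_leI flip: ennreal_mult)
    also have "\<dots> \<le> ennreal ((D * M') powr (q / p - 1)) * (ennreal D * I j k)"
      using X_I by (rule mult_left_mono) simp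
    also have "\<dots> = ennreal L * I j k"
      using D by (simp add: L_def ennreal_mult mult.assoc)
    finally show ?thesis .
  qed
  have on_ball: "(\<integral>\<^sup>+u. ennreal (?F j u powr q) * indicator (ball (z k) r) u \<partial>\<mu>)
      \<le> averaging_function s r \<mu> (z k) * (ennreal L * I j k)" if "good j" for j k
  proof -
    define a where "a = (1 + norm (z k)) powr s"
    have a: "a > 0" using norm_ge_zero[of "z k"] unfolding a_def by (simp add: add_nonneg_eq_0_iff)
    have "(\<integral>\<^sup>+u. ennreal (?F j u powr q) * indicator (ball (z k) r) u \<partial>\<mu>)
        \<le> (\<integral>\<^sup>+u. (ennreal L * I j k / ennreal a) * indicator (ball (z k) r) u \<partial>\<mu>)"
    proof (rule nn_integral_mono)
      fix u
      show "ennreal (?F j u powr q) * indicator (ball (z k) r) u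
          \<le> ennreal L * I j k / ennreal a * indicator (ball (z k) r) u"
      proof (cases "u \<in> ball (z k) r")
        case True
        have "ennreal (?F j u powr q) = ennreal (a * ?F j u powr q) / ennreal a"
          using a by (simp add: divide_ennreal)
        also have "\<dots> \<le> ennreal L * I j k / ennreal a"
          using pointwise[OF that True] by (intro divide_right_mono_ennreal) (simp add: a_def)
        finally show ?thesis using True by simp
      qed simp
    qed
    also have "\<dots> = ennreal L * I j k / ennreal a * emeasure \<mu> (ball (z k) r)"
      using ball_\<mu>(1) by (rule nn_integral_cmult_indicator)
    also have "\<dots> = averaging_function s r \<mu> (z k) * (ennreal L * I j k)"
      by (simp add: averaging_function_def a_def ennreal_divide_times mult.commute ennreal_times_divide)
    finally show ?thesis .
  qed
  have sum_I: "(\<Sum>k. I j k) \<le> ennreal (B * M')" if "good j" for j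
  proof -
    have "(\<Sum>k. I j k) = (\<integral>\<^sup>+v. (\<Sum>k. ennreal (G j v) * indicator (ball (z k) (2 * r)) v) \<partial>lborel)"
      unfolding I_def by (rule nn_integral_suminf[symmetric]) simp
    also have "\<dots> \<le> (\<integral>\<^sup>+v. ennreal B * ennreal (G j v) \<partial>lborel)"
      using overlap by (intro nn_integral_mono) (simp add: mult.commute[of "ennreal B"] mult_left_mono)
    also have "\<dots> = ennreal B * (\<integral>\<^sup>+v. ennreal (G j v) \<partial>lborel)"
      by (rule nn_integral_cmult) simp
    also have "\<dots> \<le> ennreal (B * M')"
      using that B M' by (simp add: good_def ennreal_mult mult_left_mono)
    finally show ?thesis .
  qed
  show ?thesis
    unfolding ennreal_tendsto_0_iff
  proof (intro allI impI)
    fix \<epsilon> :: real assume \<epsilon>: "\<epsilon> > 0"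
    \<comment> \<open>\<open>\<delta>\<close> is the tolerance for the averages beyond index \<open>K\<close>, \<open>\<eta>\<close> the one for \<open>f j\<close> on the remaining balls; each yields \<open>\<epsilon> / 2\<close>.\<close>
    define \<delta> where "\<delta> = \<epsilon> / (2 * (L * (B * M') + 1))"
    have LBM: "L * (B * M') \<ge> 0" using L B M' by simp
    have \<delta>: "\<delta> > 0" "\<delta> * (L * (B * M')) \<le> \<epsilon> / 2"
      using \<epsilon> LBM by (auto simp: \<delta>_def field_simps add_nonneg_pos)
    obtain K where K: "\<And>k. k \<ge> K \<Longrightarrow> averaging_function s r \<mu> (z k) \<le> ennreal \<delta>"
      using avg \<delta>(1) unfolding ennreal_tendsto_0_iff eventually_sequentially by blast
    have "bounded (\<Union>k<K. ball (z k) r)" by auto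
    then obtain R where R: "(\<Union>k<K. ball (z k) r) \<subseteq> cball 0 R"
      using bounded_subset_ballD[of _ 0] ball_subset_cball by (meson order_trans)
    define c where "c = enn2real (emeasure \<mu> (cball 0 R))"
    have c: "emeasure \<mu> (cball 0 R) = ennreal c" "c \<ge> 0"
      using \<mu> by (simp_all add: c_def positive_borel_measure_def less_top[symmetric])
    define \<eta> where "\<eta> = (\<epsilon> / (2 * (c + 1))) powr (1 / q)"
    have \<eta>: "\<eta> > 0" "\<eta> powr q * c \<le> \<epsilon> / 2"
      using \<epsilon> c(2) q by (auto simp: \<eta>_def powr_powr field_simps)
    have "\<forall>\<^sub>F j in sequentially. \<forall>u\<in>cball 0 R. norm (f j u) < \<eta>"
      using uniform_limitD[OF unif[of R] \<eta>(1)] by simp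
    with ev_good show "\<forall>\<^sub>F j in sequentially. (\<integral>\<^sup>+u. ennreal (?F j u powr q) \<partial>\<mu>) \<le> ennreal \<epsilon>"
    proof eventually_elim
      case (elim j)
      let ?f = "\<lambda>u. ennreal (?F j u powr q)"
      define tail where "tail k u = (if k < K then 0 else ?f u * indicator (ball (z k) r) u)" for k u
      have tail [measurable]: "tail k \<in> borel_measurable borel" for k
        unfolding tail_def by (cases "k < K") simp_all
      \<comment> \<open>The lattice balls cover: those with index below \<open>K\<close> lie in \<open>cball 0 R\<close>, the others are summed over.\<close>
      have "(\<integral>\<^sup>+u. ?f u \<partial>\<mu>) \<le> (\<integral>\<^sup>+u. ?f u * indicator (cball 0 R) u + (\<Sum>k. tail k u) \<partial>\<mu>)"
      proof (rule nn_integral_mono)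
        fix u
        obtain k where k: "u \<in> ball (z k) r"
          using z unfolding half_lattice_def by blast
        show "?f u \<le> ?f u * indicator (cball 0 R) u + (\<Sum>k. tail k u)"
        proof (cases "k < K")
          case True
          with k R have "u \<in> cball 0 R" by blast
          then show ?thesis by simp
        next
          case False
          have "?f u = (\<Sum>i\<in>{k}. tail i u)" using False k by (simp add: tail_def)
          also have "\<dots> \<le> (\<Sum>i. tail i u)" by (rule sum_le_suminf) auto
          finally show ?thesis by (simp add: add_increasing)
        qed
      qed
      also have "\<dots> = (\<integral>\<^sup>+u. ?f u * indicator (cball 0 R) u \<partial>\<mu>) + (\<integral>\<^sup>+u. (\<Sum>k. tail k u) \<partial>\<mu>)"
      proof (rule nn_integral_add; rule meas)
        show "(\<lambda>u. ?f u * indicator (cball 0 R) u) \<in> borel_measurable borel"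
          by (intro borel_measurable_times_ennreal borel_measurable_indicator) simp_all
      qed simp
      also have "(\<integral>\<^sup>+u. (\<Sum>k. tail k u) \<partial>\<mu>) = (\<Sum>k. \<integral>\<^sup>+u. tail k u \<partial>\<mu>)"
        by (rule nn_integral_suminf) (rule meas, rule tail)
      also have "\<dots> \<le> (\<Sum>k. ennreal (\<delta> * L) * I j k)"
      proof (intro suminf_le allI)
        fix k
        show "(\<integral>\<^sup>+u. tail k u \<partial>\<mu>) \<le> ennreal (\<delta> * L) * I j k"
        proof (cases "k < K")
          case False
          have "(\<integral>\<^sup>+u. tail k u \<partial>\<mu>) \<le> averaging_function s r \<mu> (z k) * (ennreal L * I j k)"
            using on_ball[OF elim(1)] False by (simp add: tail_def)
          also have "\<dots> \<le> ennreal \<delta> * (ennreal L * I j k)"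
            using K False by (intro mult_right_mono) auto
          finally show ?thesis using \<delta>(1) L by (simp add: ennreal_mult mult.assoc)
        qed (simp add: tail_def)
      qed auto
      also have "\<dots> = ennreal (\<delta> * L) * (\<Sum>k. I j k)"
        by simp
      also have "\<dots> \<le> ennreal (\<delta> * L) * ennreal (B * M')"
        using sum_I[OF elim(1)] by (rule mult_left_mono) simp
      also have "\<dots> = ennreal (\<delta> * (L * (B * M')))"
        using \<delta>(1) L B M' by (simp add: mult.assoc flip: ennreal_mult)
      also have "\<dots> \<le> ennreal (\<epsilon> / 2)"
        using \<delta>(2) by (rule ennreal_leI)
      also have "(\<integral>\<^sup>+u. ?f u * indicator (cball 0 R) u \<partial>\<mu>) \<le> (\<integral>\<^sup>+u. ennreal (\<eta> powr q) * indicator (cball 0 R) u \<partial>\<mu>)"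
      proof (rule nn_integral_mono)
        fix u
        show "?f u * indicator (cball 0 R) u \<le> ennreal (\<eta> powr q) * indicator (cball 0 R) u"
        proof (cases "u \<in> cball 0 R")
          case True
          have "?F j u \<le> norm (f j u) * 1"
            unfolding fock_weighted_def using \<alpha> by (intro mult_left_mono) auto
          also have "\<dots> \<le> \<eta>" using elim(2) True by (simp add: less_imp_le)
          finally have "?F j u powr q \<le> \<eta> powr q"
            using q by (intro powr_mono2) (auto simp: fock_weighted_nonneg)
          then show ?thesis by (intro mult_right_mono ennreal_leI) auto
        qed simp
      qed
      also have "\<dots> = ennreal (\<eta> powr q) * emeasure \<mu> (cball 0 R)"
        using ball_\<mu>(2) by (rule nn_integral_cmult_indicator)
      also have "\<dots> \<le> ennreal (\<epsilon> / 2)"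
        using \<eta>(2) c by (simp add: ennreal_leI flip: ennreal_mult)
      finally show "(\<integral>\<^sup>+u. ?f u \<partial>\<mu>) \<le> ennreal \<epsilon>"
        using \<epsilon> by (simp add: add_mono flip: ennreal_plus)
    qed
  qed
qed

section \<open>Normalised kernels as test functions\<close>

text \<open>
  Half of the Gaussian absorbs any power: \<open>(1 + x) powr \<tau> \<le> exp (\<tau> * x)\<close>, and completing the square
  bounds \<open>\<tau> * x\<close> by \<open>\<tau>\<^sup>2 / (2 * a) + a / 2 * x\<^sup>2\<close>.
\<close>

lemma powr_mult_gaussian_le:
  fixes a \<tau> x :: real
  assumes "a > 0" "\<tau> \<ge> 0" "x \<ge> 0"
  shows "(1 + x) powr \<tau> * exp (- a * x\<^sup>2) \<le> exp (\<tau>\<^sup>2 / (2 * a)) * exp (- (a / 2) * x\<^sup>2)"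
proof -
  have "(1 + x) powr \<tau> \<le> exp (\<tau> * x)"
    using assms exp_ge_add_one_self[of x] powr_mono2[of \<tau> "1 + x" "exp x"]
    by (simp add: exp_powr_real mult.commute)
  moreover have "\<tau> * x \<le> \<tau>\<^sup>2 / (2 * a) + a / 2 * x\<^sup>2"
  proof -
    have "0 \<le> (\<tau> - a * x)\<^sup>2 / (2 * a)" using assms by simp
    also have "\<dots> = \<tau>\<^sup>2 / (2 * a) + a / 2 * x\<^sup>2 - \<tau> * x"
      using assms by (simp add: power2_eq_square field_simps)
    finally show ?thesis by simp
  qed
  ultimately have "(1 + x) powr \<tau> \<le> exp (\<tau>\<^sup>2 / (2 * a) + a / 2 * x\<^sup>2)"
    by (meson exp_le_cancel_iff order_trans)
  then have "(1 + x) powr \<tau> * exp (- a * x\<^sup>2) \<le> exp (\<tau>\<^sup>2 / (2 * a) + a / 2 * x\<^sup>2) * exp (- a * x\<^sup>2)"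
    by (rule mult_right_mono) simp
  also have "\<dots> = exp (\<tau>\<^sup>2 / (2 * a)) * exp (- (a / 2) * x\<^sup>2)"
    by (simp flip: exp_add)
  finally show ?thesis .
qed

text \<open>
  Weights in \<open>1 + norm z\<close> and \<open>1 + norm w\<close> may be exchanged at the cost of a power of
  \<open>1 + norm (z - w)\<close>, which a Gaussian centred at \<open>w\<close> absorbs.
\<close>

lemma one_plus_norm_le:
  fixes z w :: "'a::real_normed_vector"
  shows "1 + norm z \<le> (1 + norm w) * (1 + norm (z - w))"
proof -
  have "norm z \<le> norm w + norm (z - w)"
    using norm_triangle_sub[of z w] by (simp add: add.commute)
  moreover have "0 \<le> norm w * norm (z - w)" by simp
  moreover have "(1 + norm w) * (1 + norm (z - w)) = 1 + norm w + norm (z - w) + norm w * norm (z - w)"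
    by (simp add: algebra_simps)
  ultimately show ?thesis by linarith
qed

lemma fock_weighted_exp_cinner:
  "fock_weighted \<alpha> (\<lambda>z. c * exp (of_real \<alpha> * cinner z w)) z
     = norm c * exp (\<alpha> / 2 * (norm w)\<^sup>2) * exp (- (\<alpha> / 2) * (norm (z - w))\<^sup>2)"
proof -
  have "\<alpha> * (z \<bullet> w) - \<alpha> / 2 * (norm z)\<^sup>2 = \<alpha> / 2 * (norm w)\<^sup>2 - \<alpha> / 2 * (norm (z - w))\<^sup>2"
    by (simp add: power2_norm_eq_inner inner_diff_left inner_diff_right inner_commute algebra_simps)
  then show ?thesis
    by (simp add: fock_weighted_def norm_mult Re_cinner mult.assoc flip: exp_add)
qed

text \<open>
  The reproducing kernel of the Fock space at \<open>w\<close>, normalised so that its weighted modulus is a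
  Gaussian centred at \<open>w\<close> of height \<open>(1 + norm w) powr - \<sigma>\<close>. As \<open>w\<close> tends to infinity these are the
  test functions that see \<open>\<mu>\<close> near \<open>w\<close> only.
\<close>

definition peak :: "real \<Rightarrow> real \<Rightarrow> complex ^ 'n \<Rightarrow> complex ^ 'n \<Rightarrow> complex" where
  "peak \<alpha> \<sigma> w z =
     of_real ((1 + norm w) powr - \<sigma> * exp (- (\<alpha> / 2) * (norm w)\<^sup>2)) * exp (of_real \<alpha> * cinner z w)"

lemma entire_peak: "entire (peak \<alpha> \<sigma> w)"
  unfolding peak_def by (intro entire_mult entire_const entire_exp_cinner)

lemma fock_weighted_peak:
  "fock_weighted \<alpha> (peak \<alpha> \<sigma> w) z = (1 + norm w) powr - \<sigma> * exp (- (\<alpha> / 2) * (norm (z - w))\<^sup>2)"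
  unfolding peak_def fock_weighted_exp_cinner by (simp add: norm_mult abs_mult flip: exp_add)

lemma fock_weighted_peak_powr:
  "fock_weighted \<alpha> (peak \<alpha> \<sigma> w) z powr p
     = (1 + norm w) powr - (\<sigma> * p) * exp (- (\<alpha> * p / 2) * (norm (z - w))\<^sup>2)"
  by (simp add: fock_weighted_peak powr_mult powr_powr exp_powr_real mult_ac)

lemma peak_integral_bounded:
  assumes \<alpha>: "\<alpha> > 0" and p: "p > 0" and \<sigma>: "\<sigma> \<ge> 0"
  obtains B where "B \<ge> 0" "\<And>w :: complex ^ 'n.
    (\<integral>\<^sup>+z. ennreal ((1 + norm z) powr (\<sigma> * p) * fock_weighted \<alpha> (peak \<alpha> \<sigma> w) z powr p) \<partial>lborel) \<le> ennreal B"
proof -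
  define \<tau> where "\<tau> = \<sigma> * p"
  define a where "a = \<alpha> * p / 2"
  have \<tau>: "\<tau> \<ge> 0" and a: "a > 0" using assms by (simp_all add: \<tau>_def a_def)
  define E where "E = exp (\<tau>\<^sup>2 / (2 * a))"
  let ?I = "\<integral>\<^sup>+z. ennreal (exp (- (a / 2) * (norm (z :: complex ^ 'n))\<^sup>2)) \<partial>lborel"
  have fin: "?I < \<infinity>"
    using nn_integral_gaussian_finite[of "a / 2" "0 :: complex ^ 'n"] a by simp
  show ?thesis
  proof (rule that[of "E * enn2real ?I"])
    show "0 \<le> E * enn2real ?I" by (simp add: E_def)
    fix w :: "complex ^ 'n"
    have "(1 + norm z) powr \<tau> * fock_weighted \<alpha> (peak \<alpha> \<sigma> w) z powr p
        \<le> E * exp (- (a / 2) * (norm (z - w))\<^sup>2)" for z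
    proof -
      have "(1 + norm z) powr \<tau> \<le> (1 + norm w) powr \<tau> * (1 + norm (z - w)) powr \<tau>"
        using one_plus_norm_le[of z w] \<tau> by (simp add: powr_mono2 flip: powr_mult)
      then have "(1 + norm z) powr \<tau> * ((1 + norm w) powr - \<tau> * exp (- a * (norm (z - w))\<^sup>2))
          \<le> (1 + norm w) powr \<tau> * (1 + norm (z - w)) powr \<tau> * ((1 + norm w) powr - \<tau> * exp (- a * (norm (z - w))\<^sup>2))"
        by (rule mult_right_mono) simp
      also have "\<dots> = (1 + norm (z - w)) powr \<tau> * exp (- a * (norm (z - w))\<^sup>2)"
        using norm_ge_zero[of w] by (simp add: powr_minus field_simps add_nonneg_eq_0_iff)
      also have "\<dots> \<le> E * exp (- (a / 2) * (norm (z - w))\<^sup>2)"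
        unfolding E_def using a \<tau> by (intro powr_mult_gaussian_le) auto
      finally show ?thesis by (simp add: fock_weighted_peak_powr \<tau>_def a_def)
    qed
    then have "(\<integral>\<^sup>+z. ennreal ((1 + norm z) powr \<tau> * fock_weighted \<alpha> (peak \<alpha> \<sigma> w) z powr p) \<partial>lborel)
        \<le> (\<integral>\<^sup>+z. ennreal (E * exp (- (a / 2) * (norm (z - w))\<^sup>2)) \<partial>lborel)"
      by (intro nn_integral_mono ennreal_leI)
    also have "\<dots> = (\<integral>\<^sup>+z. ennreal (E * exp (- (a / 2) * (norm (z :: complex ^ 'n))\<^sup>2)) \<partial>lborel)"
      using nn_integral_lborel_translate[of "\<lambda>z. ennreal (E * exp (- (a / 2) * (norm z)\<^sup>2))" "- w"] by simp
    also have "\<dots> = ennreal E * ?I"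
      by (simp add: E_def ennreal_mult nn_integral_cmult)
    also have "\<dots> = ennreal (E * enn2real ?I)"
      using fin by (simp add: E_def ennreal_mult less_top)
    finally show "(\<integral>\<^sup>+z. ennreal ((1 + norm z) powr (\<sigma> * p) * fock_weighted \<alpha> (peak \<alpha> \<sigma> w) z powr p) \<partial>lborel)
        \<le> ennreal (E * enn2real ?I)"
      by (simp add: \<tau>_def)
  qed
qed

text \<open>
  If \<open>norm z \<le> R\<close>, the modulus of the peak at \<open>z\<close> is at most
  \<open>exp (\<alpha> * R * norm w - \<alpha> / 2 * (norm w)\<^sup>2)\<close>, where the quadratic term wins.
\<close>

lemma peak_uniform_limit:
  fixes w :: "nat \<Rightarrow> complex ^ 'n"
  assumes \<alpha>: "\<alpha> > 0" and \<sigma>: "\<sigma> \<ge> 0" and w: "filterlim w at_infinity sequentially" and K: "bounded K"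
  shows "uniform_limit K (\<lambda>j. peak \<alpha> \<sigma> (w j)) (\<lambda>_. 0) sequentially"
proof -
  obtain R where R: "\<And>z. z \<in> K \<Longrightarrow> norm z \<le> R" using K by (auto simp: bounded_iff)
  let ?g = "\<lambda>x :: real. exp (\<alpha> * R * x - \<alpha> / 2 * x\<^sup>2)"
  have "(?g \<longlongrightarrow> 0) at_top" using \<alpha> by real_asymp
  moreover have "filterlim (\<lambda>j. norm (w j)) at_top sequentially"
    using w by (simp add: filterlim_at_infinity_conv_norm_at_top)
  ultimately have lim: "(\<lambda>j. ?g (norm (w j))) \<longlonglongrightarrow> 0"
    by (rule filterlim_compose)
  have bound: "norm (peak \<alpha> \<sigma> (w j) z) \<le> ?g (norm (w j))" if "z \<in> K" for j z
  proof -
    have "z \<bullet> w j \<le> norm z * norm (w j)" by (rule norm_cauchy_schwarz)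
    also have "\<dots> \<le> R * norm (w j)" using R[OF that] by (rule mult_right_mono) simp
    finally have "\<alpha> * (z \<bullet> w j) \<le> \<alpha> * R * norm (w j)" using \<alpha> by simp
    moreover have "(1 + norm (w j)) powr - \<sigma> \<le> 1"
      using powr_mono[of "- \<sigma>" 0 "1 + norm (w j)"] \<sigma> by (simp split: if_splits)
    ultimately have "(1 + norm (w j)) powr - \<sigma> * exp (\<alpha> * (z \<bullet> w j) - \<alpha> / 2 * (norm (w j))\<^sup>2) \<le> 1 * ?g (norm (w j))"
      by (intro mult_mono) auto
    moreover have "norm (peak \<alpha> \<sigma> (w j) z)
        = (1 + norm (w j)) powr - \<sigma> * exp (\<alpha> * (z \<bullet> w j) - \<alpha> / 2 * (norm (w j))\<^sup>2)"
      by (simp add: peak_def norm_mult Re_cinner abs_mult mult.assoc flip: exp_add)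
    ultimately show ?thesis by simp
  qed
  show ?thesis
    unfolding uniform_limit_iff
  proof (intro allI impI)
    fix e :: real assume "e > 0"
    with lim have "\<forall>\<^sub>F j in sequentially. ?g (norm (w j)) < e"
      by (rule order_tendstoD(2))
    then show "\<forall>\<^sub>F j in sequentially. \<forall>z\<in>K. dist (peak \<alpha> \<sigma> (w j) z) 0 < e"
      by (rule eventually_mono) (use bound in \<open>auto intro: le_less_trans\<close>)
  qed
qed

text \<open>
  Partial derivatives only multiply an exponential of this kind by constants, in whatever
  order they are taken, so that membership in the Fock-Sobolev space of any order reduces to
  the integrability of a Gaussian.
\<close>

lemma cpartial_exp_cinner:
  "cpartial i (\<lambda>z. c * exp (a * cinner z w)) = (\<lambda>z. (c * (a * cnj (w $ i))) * exp (a * cinner z w))"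
proof
  fix z
  have "cinner (axis i x) w = x * cnj (w $ i)" for x
    by (simp add: cinner_def axis_def if_distrib[of "\<lambda>x. x * _"] cong: if_cong)
  then have "cpartial i (\<lambda>z. c * exp (a * cinner z w)) z
      = deriv (\<lambda>x. c * exp (a * (cinner z w + x * cnj (w $ i)))) 0"
    by (simp add: cpartial_def cinner_add)
  also have "\<dots> = (c * (a * cnj (w $ i))) * exp (a * cinner z w)"
    by (rule DERIV_imp_deriv) (auto intro!: derivative_eq_intros)
  finally show "cpartial i (\<lambda>z. c * exp (a * cinner z w)) z = (c * (a * cnj (w $ i))) * exp (a * cinner z w)" .
qed

lemma multi_partial_exp_cinner:
  "\<exists>d. multi_partial \<beta> (\<lambda>z. c * exp (a * cinner z w)) = (\<lambda>z. d * exp (a * cinner z w))"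
proof -
  have pow: "\<exists>d. (cpartial i ^^ k) (\<lambda>z. c * exp (a * cinner z w)) = (\<lambda>z. d * exp (a * cinner z w))" for i k c
  proof (induction k)
    case (Suc k)
    then show ?case by (auto simp: cpartial_exp_cinner)
  qed auto
  have "\<exists>d. foldr (\<lambda>i. cpartial i ^^ \<beta> i) is (\<lambda>z. c * exp (a * cinner z w)) = (\<lambda>z. d * exp (a * cinner z w))" for "is"
  proof (induction "is")
    case (Cons i "is")
    then show ?case using pow[of "\<beta> i" i] by auto
  qed auto
  then show ?thesis by (simp add: multi_partial_def)
qed

lemma ennreal_rpow_finite: "x < \<infinity> \<Longrightarrow> ennreal_rpow x a < \<infinity>"
  by (simp add: ennreal_rpow_def)

lemma peak_in_fock_sobolev:
  assumes \<alpha>: "\<alpha> > 0" and p: "p > 0"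
  shows "peak \<alpha> \<sigma> w \<in> fock_sobolev p m \<alpha>"
proof -
  have "fock_norm \<alpha> p (multi_partial \<beta> (peak \<alpha> \<sigma> w)) < \<infinity>" for \<beta>
  proof -
    obtain d where d: "multi_partial \<beta> (peak \<alpha> \<sigma> w) = (\<lambda>z. d * exp (of_real \<alpha> * cinner z w))"
      using multi_partial_exp_cinner unfolding peak_def by blast
    define c where "c = (norm d * exp (\<alpha> / 2 * (norm w)\<^sup>2)) powr p"
    have "norm (multi_partial \<beta> (peak \<alpha> \<sigma> w) z) powr p * exp (- (\<alpha> * p / 2) * (norm z)\<^sup>2)
        = c * exp (- (\<alpha> * p / 2) * (norm (z - w))\<^sup>2)" for z
    proof -
      have "norm (multi_partial \<beta> (peak \<alpha> \<sigma> w) z) powr p * exp (- (\<alpha> * p / 2) * (norm z)\<^sup>2)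
          = (norm d * exp (\<alpha> / 2 * (norm w)\<^sup>2) * exp (- (\<alpha> / 2) * (norm (z - w))\<^sup>2)) powr p"
        by (simp only: d fock_weighted_exp_cinner[symmetric] fock_weighted_powr)
      also have "\<dots> = c * exp (- (\<alpha> / 2) * (norm (z - w))\<^sup>2) powr p"
        unfolding c_def by (rule powr_mult)
      also have "exp (- (\<alpha> / 2) * (norm (z - w))\<^sup>2) powr p = exp (- (\<alpha> * p / 2) * (norm (z - w))\<^sup>2)"
        by (simp add: exp_powr_real mult_ac)
      finally show ?thesis .
    qed
    then have "(\<integral>\<^sup>+z. ennreal (norm (multi_partial \<beta> (peak \<alpha> \<sigma> w) z) powr p * exp (- (\<alpha> * p / 2) * (norm z)\<^sup>2)) \<partial>lborel)
        = (\<integral>\<^sup>+z. ennreal c * ennreal (exp (- (\<alpha> * p / 2) * (norm (z - w))\<^sup>2)) \<partial>lborel)"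
      by (simp add: c_def flip: ennreal_mult)
    also have "\<dots> = ennreal c * (\<integral>\<^sup>+z. ennreal (exp (- (\<alpha> * p / 2) * (norm (z - w))\<^sup>2)) \<partial>lborel)"
      by (rule nn_integral_cmult) simp
    also have "\<dots> < \<infinity>"
      using nn_integral_gaussian_finite[of "\<alpha> * p / 2" w] \<alpha> p by (simp add: ennreal_mult_less_top)
    finally show ?thesis
      unfolding fock_norm_def by (intro ennreal_rpow_finite) (simp add: ennreal_mult_less_top)
  qed
  then show ?thesis
    using entire_peak by (auto simp: fock_sobolev_def finite_multi_indices)
qed

section \<open>The equivalences\<close>

lemma gaussian_translate_weight_le:
  fixes z w :: "'a::real_normed_vector"
  assumes "a > 0" "s \<ge> 0"
  shows "(1 + norm z) powr - s * exp (- a * (norm (z - w))\<^sup>2)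
     \<le> exp (s\<^sup>2 / (2 * a)) * ((1 + norm w) powr - s * exp (- (a / 2) * (norm (z - w))\<^sup>2))"
proof -
  have "(1 + norm w) powr s \<le> ((1 + norm z) * (1 + norm (z - w))) powr s"
    using one_plus_norm_le[of w z] assms by (intro powr_mono2) (simp_all add: norm_minus_commute)
  then have "(1 + norm w) powr s \<le> (1 + norm z) powr s * (1 + norm (z - w)) powr s"
    by (simp add: powr_mult)
  then have "(1 + norm z) powr - s \<le> (1 + norm w) powr - s * (1 + norm (z - w)) powr s"
    using norm_ge_zero[of z] norm_ge_zero[of w]
    by (simp add: powr_minus field_simps add_nonneg_eq_0_iff)
  then have "(1 + norm z) powr - s * exp (- a * (norm (z - w))\<^sup>2)
      \<le> (1 + norm w) powr - s * (1 + norm (z - w)) powr s * exp (- a * (norm (z - w))\<^sup>2)"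
    by (rule mult_right_mono) simp
  also have "\<dots> = (1 + norm w) powr - s * ((1 + norm (z - w)) powr s * exp (- a * (norm (z - w))\<^sup>2))"
    by (rule mult.assoc)
  also have "\<dots> \<le> (1 + norm w) powr - s * (exp (s\<^sup>2 / (2 * a)) * exp (- (a / 2) * (norm (z - w))\<^sup>2))"
    using assms by (intro mult_left_mono powr_mult_gaussian_le) auto
  finally show ?thesis by (simp only: mult.left_commute)
qed

lemma ennreal_tendsto_0_bound:
  assumes "(Y \<longlongrightarrow> 0) F" and "\<And>x. X x \<le> ennreal C * Y x"
  shows "(X \<longlongrightarrow> (0::ennreal)) F"
proof (rule tendsto_sandwich[of "\<lambda>_. 0" X F "\<lambda>x. ennreal C * Y x"])
  show "((\<lambda>x. ennreal C * Y x) \<longlongrightarrow> 0) F"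
    using ennreal_tendsto_cmult[OF _ assms(1), of "ennreal C"] by simp
qed (use assms(2) in auto)

text \<open>
  On \<open>ball w r\<close> the Gaussian centred at \<open>w\<close> is bounded below, so averages are dominated by Gaussian
  integrals.
\<close>

lemma averaging_le_integral:
  assumes \<mu>: "positive_borel_measure \<mu>" and a: "a \<ge> 0"
  shows "averaging_function s r \<mu> w \<le> ennreal (exp (a * r\<^sup>2)) *
     (\<integral>\<^sup>+z. ennreal ((1 + norm w) powr - s * exp (- a * (norm (z - w))\<^sup>2)) \<partial>\<mu>)"
proof -
  have sets: "sets \<mu> = sets borel" using \<mu> by (simp add: positive_borel_measure_def)
  have "(\<lambda>z. ennreal ((1 + norm w) powr - s * exp (- a * (norm (z - w))\<^sup>2))) \<in> borel_measurable borel"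
    by measurable
  then have meas: "(\<lambda>z. ennreal ((1 + norm w) powr - s * exp (- a * (norm (z - w))\<^sup>2))) \<in> borel_measurable \<mu>"
    by (rule positive_borel_measure_measurable[OF \<mu>])
  have "averaging_function s r \<mu> w = ennreal ((1 + norm w) powr - s) * emeasure \<mu> (ball w r)"
    unfolding averaging_function_def powr_minus divide_ennreal_def
    using norm_ge_zero[of w] by (subst inverse_ennreal) (auto simp: add_nonneg_eq_0_iff mult.commute)
  also have "\<dots> = (\<integral>\<^sup>+z. ennreal ((1 + norm w) powr - s) * indicator (ball w r) z \<partial>\<mu>)"
    using sets by (subst nn_integral_cmult_indicator) simp_all
  also have "\<dots> \<le> (\<integral>\<^sup>+z. ennreal (exp (a * r\<^sup>2)) * ennreal ((1 + norm w) powr - s * exp (- a * (norm (z - w))\<^sup>2)) \<partial>\<mu>)"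
  proof (rule nn_integral_mono)
    fix z
    show "ennreal ((1 + norm w) powr - s) * indicator (ball w r) z
        \<le> ennreal (exp (a * r\<^sup>2)) * ennreal ((1 + norm w) powr - s * exp (- a * (norm (z - w))\<^sup>2))"
    proof (cases "z \<in> ball w r")
      case True
      then have "(norm (z - w))\<^sup>2 \<le> r\<^sup>2"
        by (simp add: dist_norm norm_minus_commute power_mono)
      then have "1 \<le> exp (a * r\<^sup>2) * exp (- a * (norm (z - w))\<^sup>2)"
        using a by (simp add: mult_left_mono flip: exp_add)
      then have "(1 + norm w) powr - s * 1 \<le> (1 + norm w) powr - s * (exp (a * r\<^sup>2) * exp (- a * (norm (z - w))\<^sup>2))"
        by (rule mult_left_mono) simp
      then show ?thesis
        using True by (simp add: ennreal_leI mult_ac flip: ennreal_mult)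
    qed simp
  qed
  also have "\<dots> = ennreal (exp (a * r\<^sup>2)) * (\<integral>\<^sup>+z. ennreal ((1 + norm w) powr - s * exp (- a * (norm (z - w))\<^sup>2)) \<partial>\<mu>)"
    using meas by (rule nn_integral_cmult)
  finally show ?thesis .
qed

text \<open>
  The Berezin type transform carries the weight at the integration variable. To have it at \<open>w\<close>
  instead, start from the average with a Gaussian twice as steep and spend half of it on the change
  of weight.
\<close>

lemma berezin_imp_averaging:
  fixes \<mu> :: "(complex ^ 'n) measure"
  assumes \<alpha>: "\<alpha> > 0" and t: "t > 0" and s: "s \<ge> 0"
    and \<mu>: "positive_borel_measure \<mu>"
    and lim: "(berezin_transform \<alpha> t s \<mu> \<longlongrightarrow> 0) at_infinity"
  shows "(averaging_function s r \<mu> \<longlongrightarrow> 0) at_infinity"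
proof (rule ennreal_tendsto_0_bound[OF lim])
  fix w :: "complex ^ 'n"
  define a where "a = t * \<alpha> / 2"
  have a: "a > 0" using \<alpha> t by (simp add: a_def)
  have "(\<lambda>z. ennreal ((1 + norm z) powr - s * exp (- a * (norm (z - w))\<^sup>2))) \<in> borel_measurable borel"
    by measurable
  then have meas: "(\<lambda>z. ennreal ((1 + norm z) powr - s * exp (- a * (norm (z - w))\<^sup>2))) \<in> borel_measurable \<mu>"
    by (rule positive_borel_measure_measurable[OF \<mu>])
  have "averaging_function s r \<mu> w \<le> ennreal (exp (2 * a * r\<^sup>2)) *
     (\<integral>\<^sup>+z. ennreal ((1 + norm w) powr - s * exp (- (2 * a) * (norm (z - w))\<^sup>2)) \<partial>\<mu>)"
    using averaging_le_integral[OF \<mu>, of "2 * a"] a by simp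
  also have "(\<integral>\<^sup>+z. ennreal ((1 + norm w) powr - s * exp (- (2 * a) * (norm (z - w))\<^sup>2)) \<partial>\<mu>)
      \<le> (\<integral>\<^sup>+z. ennreal (exp (s\<^sup>2 / (2 * (2 * a)))) * ennreal ((1 + norm z) powr - s * exp (- a * (norm (z - w))\<^sup>2)) \<partial>\<mu>)"
  proof (rule nn_integral_mono)
    fix z
    show "ennreal ((1 + norm w) powr - s * exp (- (2 * a) * (norm (z - w))\<^sup>2))
       \<le> ennreal (exp (s\<^sup>2 / (2 * (2 * a)))) * ennreal ((1 + norm z) powr - s * exp (- a * (norm (z - w))\<^sup>2))"
      using gaussian_translate_weight_le[of "2 * a" s w z] a s
      by (simp add: ennreal_leI norm_minus_commute flip: ennreal_mult)
  qed
  also have "\<dots> = ennreal (exp (s\<^sup>2 / (2 * (2 * a)))) * berezin_transform \<alpha> t s \<mu> w"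
    using meas unfolding berezin_transform_def a_def by (rule nn_integral_cmult)
  finally show "averaging_function s r \<mu> w
      \<le> ennreal (exp (2 * a * r\<^sup>2) * exp (s\<^sup>2 / (2 * (2 * a)))) * berezin_transform \<alpha> t s \<mu> w"
    by (simp add: ennreal_mult mult.assoc mult_left_mono)
qed

text \<open>
  The transform at \<open>w\<close> with parameter \<open>t\<close> is dominated by a multiple of the \<open>\<mu>\<close>-integral of
  \<open>fock_weighted \<alpha> (peak \<alpha> \<sigma> w) powr p\<close> with \<open>p = t / 2\<close> and \<open>\<sigma> * p = s\<close>; the other half of \<open>t\<close> pays for moving
  the weight from \<open>z\<close> to \<open>w\<close>. So this is an instance of the convergence of integrals along bounded
  sequences, for both exponents equal to \<open>t / 2\<close>, irrespective of the exponents of the theorem.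
\<close>

lemma lattice_imp_berezin:
  fixes \<mu> :: "(complex ^ 'n) measure"
  assumes \<alpha>: "\<alpha> > 0" and t: "t > 0" and s: "s \<ge> 0"
    and \<mu>: "positive_borel_measure \<mu>"
    and r: "r > 0" and z: "half_lattice r z"
    and avg: "(\<lambda>k. averaging_function s r \<mu> (z k)) \<longlonglongrightarrow> 0"
  shows "(berezin_transform \<alpha> t s \<mu> \<longlongrightarrow> 0) at_infinity"
proof (rule tendsto_at_infinity_sequentially)
  fix w :: "nat \<Rightarrow> complex ^ 'n"
  assume w: "filterlim w at_infinity sequentially"
  define p where "p = t / 2"
  define \<sigma> where "\<sigma> = s / p"
  have p: "p > 0" and \<sigma>: "\<sigma> \<ge> 0" and \<sigma>p: "\<sigma> * p = s" using t s by (auto simp: p_def \<sigma>_def)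
  let ?F = "\<lambda>j. fock_weighted \<alpha> (peak \<alpha> \<sigma> (w j))"
  obtain B where B: "\<And>w :: complex ^ 'n.
    (\<integral>\<^sup>+z. ennreal ((1 + norm z) powr (\<sigma> * p) * fock_weighted \<alpha> (peak \<alpha> \<sigma> w) z powr p) \<partial>lborel) \<le> ennreal B"
    using peak_integral_bounded[OF \<alpha> p \<sigma>] by blast
  have lim: "(\<lambda>j. \<integral>\<^sup>+u. ennreal (?F j u powr p) \<partial>\<mu>) \<longlonglongrightarrow> 0"
  proof (rule carleson_sequence_tendsto_0[OF \<alpha> p order_refl s \<mu> r z avg entire_peak])
    show "\<forall>\<^sub>F j in sequentially. (\<integral>\<^sup>+u. ennreal ((1 + norm u) powr (s * p / p) * ?F j u powr p) \<partial>lborel) \<le> ennreal B"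
      using B p \<sigma>p by simp
    show "uniform_limit (cball 0 R) (\<lambda>j. peak \<alpha> \<sigma> (w j)) (\<lambda>_. 0) sequentially" for R
      by (rule peak_uniform_limit[OF \<alpha> \<sigma> w bounded_cball])
  qed
  show "(\<lambda>j. berezin_transform \<alpha> t s \<mu> (w j)) \<longlonglongrightarrow> 0"
  proof (rule ennreal_tendsto_0_bound[OF lim])
    fix j
    have "?F j \<in> borel_measurable borel"
      by (rule fock_weighted_borel_measurable[OF entire_peak])
    then have "(\<lambda>u. ennreal (?F j u powr p)) \<in> borel_measurable borel" by measurable
    then have meas: "(\<lambda>u. ennreal (?F j u powr p)) \<in> borel_measurable \<mu>"
      by (rule positive_borel_measure_measurable[OF \<mu>])
    have "berezin_transform \<alpha> t s \<mu> (w j)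
        \<le> (\<integral>\<^sup>+u. ennreal (exp (s\<^sup>2 / (2 * (t * \<alpha> / 2)))) * ennreal (?F j u powr p) \<partial>\<mu>)"
      unfolding berezin_transform_def
    proof (rule nn_integral_mono)
      fix u
      have "?F j u powr p = (1 + norm (w j)) powr - s * exp (- (t * \<alpha> / 2 / 2) * (norm (u - w j))\<^sup>2)"
        unfolding fock_weighted_peak_powr \<sigma>p by (simp add: p_def mult.commute)
      then show "ennreal ((1 + norm u) powr - s * exp (- (t * \<alpha> / 2) * (norm (u - w j))\<^sup>2))
          \<le> ennreal (exp (s\<^sup>2 / (2 * (t * \<alpha> / 2)))) * ennreal (?F j u powr p)"
        using gaussian_translate_weight_le[of "t * \<alpha> / 2" s u "w j"] t \<alpha> s
        by (simp add: ennreal_leI flip: ennreal_mult)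
    qed
    also have "\<dots> = ennreal (exp (s\<^sup>2 / (2 * (t * \<alpha> / 2)))) * (\<integral>\<^sup>+u. ennreal (?F j u powr p) \<partial>\<mu>)"
      using meas by (rule nn_integral_cmult)
    finally show "berezin_transform \<alpha> t s \<mu> (w j)
        \<le> ennreal (exp (s\<^sup>2 / (2 * (t * \<alpha> / 2)))) * (\<integral>\<^sup>+u. ennreal (?F j u powr p) \<partial>\<mu>)" .
  qed
qed

lemma fock_sobolev_const_pos:
  assumes "\<alpha> > 0" "p > 0" "n > 0"
  shows "fock_sobolev_const p m \<alpha> n > 0"
  unfolding fock_sobolev_const_def using assms
  by (intro mult_pos_pos divide_pos_pos Gamma_real_pos) (auto intro: add_nonneg_pos)

lemma fock_sobolev_norm_le_iff:
  fixes f :: "complex ^ 'n \<Rightarrow> complex"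
  assumes \<alpha>: "\<alpha> > 0" and p: "p > 0" and A: "A \<ge> 0"
  shows "fock_sobolev_norm p m \<alpha> f \<le> ennreal A \<longleftrightarrow>
     (\<integral>\<^sup>+z. ennreal ((norm z ^ m) powr p * fock_weighted \<alpha> f z powr p) \<partial>lborel)
       \<le> ennreal (A powr p / fock_sobolev_const p m \<alpha> CARD('n))"
proof -
  define c where "c = fock_sobolev_const p m \<alpha> CARD('n)"
  have c: "c > 0" unfolding c_def using \<alpha> p by (intro fock_sobolev_const_pos) auto
  let ?I = "\<integral>\<^sup>+z. ennreal ((norm z ^ m) powr p * fock_weighted \<alpha> f z powr p) \<partial>lborel"
  have eq: "fock_sobolev_norm p m \<alpha> f = ennreal_rpow (ennreal c * ?I) (1 / p)"
    by (simp add: fock_sobolev_norm_def c_def fock_weighted_powr mult.assoc)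
  show ?thesis
  proof (cases "?I")
    case top
    then show ?thesis using c unfolding eq c_def[symmetric] by (simp add: ennreal_rpow_def ennreal_mult_top top_unique)
  next
    case (real x)
    then have "fock_sobolev_norm p m \<alpha> f = ennreal ((c * x) powr (1 / p))"
      unfolding eq using c by (simp add: ennreal_rpow_def flip: ennreal_mult)
    moreover have "(c * x) powr (1 / p) \<le> A \<longleftrightarrow> x \<le> A powr p / c"
    proof -
      have "(c * x) powr (1 / p) \<le> A \<longleftrightarrow> ((c * x) powr (1 / p)) powr p \<le> A powr p"
        using p A by (meson powr_ge_zero powr_less_mono2 powr_mono2 less_imp_le not_le)
      also have "((c * x) powr (1 / p)) powr p = c * x"
        using p c real by (simp add: powr_powr)
      finally show ?thesis using c by (simp add: field_simps)
    qed
    ultimately show ?thesis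
      using real A c by (simp add: c_def)
  qed
qed

text \<open>
  Test the Carleson property on the peaks with \<open>\<sigma> = m\<close>: they are bounded in the Fock-Sobolev norm,
  tend to 0 locally uniformly as their centres \<open>w\<close> go to infinity, and their \<open>q\<close>-integrals dominate the
  averages at \<open>w\<close>.
\<close>

lemma vanishing_imp_averaging:
  fixes \<mu> :: "(complex ^ 'n) measure"
  assumes \<alpha>: "\<alpha> > 0" and p: "0 < p" and q: "0 < q"
    and \<mu>: "positive_borel_measure \<mu>"
    and vanishing: "vanishing_fock_carleson p q m \<alpha> \<mu>"
  shows "(averaging_function (real m * q) r \<mu> \<longlongrightarrow> 0) at_infinity"
proof (rule tendsto_at_infinity_sequentially)
  fix w :: "nat \<Rightarrow> complex ^ 'n"
  assume w: "filterlim w at_infinity sequentially"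
  let ?f = "\<lambda>j. peak \<alpha> (real m) (w j)"
  obtain B where "B \<ge> 0" and B: "\<And>w :: complex ^ 'n.
    (\<integral>\<^sup>+z. ennreal ((1 + norm z) powr (real m * p) * fock_weighted \<alpha> (peak \<alpha> (real m) w) z powr p) \<partial>lborel) \<le> ennreal B"
    using peak_integral_bounded[OF \<alpha> p, of "real m"] by auto
  define c where "c = fock_sobolev_const p m \<alpha> CARD('n)"
  have c: "c > 0" unfolding c_def using \<alpha> p by (intro fock_sobolev_const_pos) auto
  define A where "A = (c * B) powr (1 / p)"
  have A: "A \<ge> 0" "A powr p / c = B"
    using c p \<open>B \<ge> 0\<close> by (simp_all add: A_def powr_powr)
  have "fock_sobolev_norm p m \<alpha> (?f j) \<le> ennreal A" for j
    unfolding fock_sobolev_norm_le_iff[OF \<alpha> p A(1)] c_def[symmetric] A(2)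
  proof (rule order_trans[OF nn_integral_mono B])
    fix z :: "complex ^ 'n"
    have "(norm z ^ m) powr p \<le> ((1 + norm z) ^ m) powr p"
      using p by (intro powr_mono2 power_mono) auto
    also have "\<dots> = (1 + norm z) powr (real m * p)"
      by (simp add: powr_powr add_pos_nonneg flip: powr_realpow)
    finally show "ennreal ((norm z ^ m) powr p * fock_weighted \<alpha> (?f j) z powr p)
        \<le> ennreal ((1 + norm z) powr (real m * p) * fock_weighted \<alpha> (?f j) z powr p)"
      by (intro ennreal_leI mult_right_mono) simp_all
  qed
  then have "(SUP j. fock_sobolev_norm p m \<alpha> (?f j)) \<le> ennreal A" by (intro SUP_least)
  then have "(SUP j. fock_sobolev_norm p m \<alpha> (?f j)) < \<infinity>"
    using le_less_trans by fastforce
  moreover have "uniform_limit K ?f (\<lambda>z. 0) sequentially" if "compact K" for K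
    using peak_uniform_limit[OF \<alpha> _ w compact_imp_bounded[OF that]] by simp
  ultimately have "(\<lambda>j. \<integral>\<^sup>+z. ennreal (norm (?f j z) powr q * exp (- (q * \<alpha> / 2) * (norm z)\<^sup>2)) \<partial>\<mu>) \<longlonglongrightarrow> 0"
    using peak_in_fock_sobolev[OF \<alpha> p]
    by (intro vanishing[unfolded vanishing_fock_carleson_def, rule_format])
  then have lim: "(\<lambda>j. \<integral>\<^sup>+z. ennreal (fock_weighted \<alpha> (?f j) z powr q) \<partial>\<mu>) \<longlonglongrightarrow> 0"
    by (simp add: fock_weighted_powr mult.commute[of q])
  show "(\<lambda>j. averaging_function (real m * q) r \<mu> (w j)) \<longlonglongrightarrow> 0"
  proof (rule ennreal_tendsto_0_bound[OF lim])
    show "averaging_function (real m * q) r \<mu> (w j)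
        \<le> ennreal (exp (\<alpha> * q / 2 * r\<^sup>2)) * (\<integral>\<^sup>+z. ennreal (fock_weighted \<alpha> (?f j) z powr q) \<partial>\<mu>)" for j
      unfolding fock_weighted_peak_powr using \<alpha> q by (intro averaging_le_integral[OF \<mu>]) simp
  qed
qed

text \<open>
  The Fock-Sobolev norm has the weight \<open>norm z ^ m\<close>, which vanishes at the origin if \<open>m > 0\<close>, instead
  of a power of \<open>1 + norm z\<close>. The two are comparable outside the unit ball, and inside it the uniform
  convergence to 0 gives the bound for all but finitely many members of the sequence.
\<close>

lemma lattice_imp_vanishing:
  fixes \<mu> :: "(complex ^ 'n) measure"
  assumes \<alpha>: "\<alpha> > 0" and p: "0 < p" "p \<le> q"
    and \<mu>: "positive_borel_measure \<mu>"
    and r: "r > 0" and z: "half_lattice r z"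
    and avg: "(\<lambda>k. averaging_function (real m * q) r \<mu> (z k)) \<longlonglongrightarrow> 0"
  shows "vanishing_fock_carleson p q m \<alpha> \<mu>"
  unfolding vanishing_fock_carleson_def
proof (intro allI impI)
  fix f :: "nat \<Rightarrow> complex ^ 'n \<Rightarrow> complex"
  assume f: "\<forall>j. f j \<in> fock_sobolev p m \<alpha>"
    and sup: "(SUP j. fock_sobolev_norm p m \<alpha> (f j)) < \<infinity>"
    and unif: "\<forall>K. compact K \<longrightarrow> uniform_limit K f (\<lambda>z. 0) sequentially"
  have entire: "entire (f j)" for j using f by (auto simp: fock_sobolev_def)
  define A where "A = enn2real (SUP j. fock_sobolev_norm p m \<alpha> (f j))"
  have A: "fock_sobolev_norm p m \<alpha> (f j) \<le> ennreal A" for j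
  proof -
    have "fock_sobolev_norm p m \<alpha> (f j) \<le> (SUP j. fock_sobolev_norm p m \<alpha> (f j))" by (rule SUP_upper) simp
    then show ?thesis using sup by (simp add: A_def)
  qed
  have A0: "A \<ge> 0" by (simp add: A_def)
  define N where "N = A powr p / fock_sobolev_const p m \<alpha> CARD('n)"
  have N0: "N \<ge> 0" unfolding N_def using fock_sobolev_const_pos[OF \<alpha> p(1), of "CARD('n)" m] by simp
  let ?F = "\<lambda>j. fock_weighted \<alpha> (f j)"
  have N: "(\<integral>\<^sup>+z. ennreal ((norm z ^ m) powr p * ?F j z powr p) \<partial>lborel) \<le> ennreal N" for j
    using A[of j] fock_sobolev_norm_le_iff[OF \<alpha> p(1) A0, of m "f j"] by (simp add: N_def)
  define W where "W = 2 powr (real m * p)"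
  define V where "V = enn2real (emeasure lborel (cball (0 :: complex ^ 'n) 1))"
  have V: "emeasure lborel (cball (0 :: complex ^ 'n) 1) = ennreal V"
    using emeasure_lborel_cball_finite[of "0 :: complex ^ 'n" 1] by (simp add: V_def less_top)
  have W: "W \<ge> 0" by (simp add: W_def)
  have "\<forall>\<^sub>F j in sequentially. \<forall>u\<in>cball 0 1. norm (f j u) < 1"
    using uniform_limitD[OF unif[rule_format, OF compact_cball[of 0 1]], of 1] by simp
  then have bounded: "\<forall>\<^sub>F j in sequentially.
      (\<integral>\<^sup>+u. ennreal ((1 + norm u) powr (real m * q * p / q) * ?F j u powr p) \<partial>lborel) \<le> ennreal (W * (V + N))"
  proof eventually_elim
    case (elim j)
    have [measurable]: "?F j \<in> borel_measurable borel"
      by (rule fock_weighted_borel_measurable[OF entire])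
    have "(1 + norm u) powr (real m * q * p / q) * ?F j u powr p
        \<le> W * (indicator (cball 0 1) u + (norm u ^ m) powr p * ?F j u powr p)" for u
    proof (cases "u \<in> cball 0 1")
      case True
      have "?F j u \<le> norm (f j u) * 1"
        unfolding fock_weighted_def using \<alpha> by (intro mult_left_mono) auto
      also have "\<dots> \<le> 1" using elim True by (simp add: less_imp_le)
      finally have "?F j u powr p \<le> 1 powr p"
        using p by (intro powr_mono2) (auto simp: fock_weighted_nonneg)
      moreover have "(1 + norm u) powr (real m * p) \<le> W"
        unfolding W_def using True p by (intro powr_mono2) auto
      ultimately have "(1 + norm u) powr (real m * p) * ?F j u powr p \<le> W * 1"
        using W by (intro mult_mono) auto
      also have "\<dots> \<le> W * (indicator (cball 0 1) u + (norm u ^ m) powr p * ?F j u powr p)"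
        using True W by (intro mult_left_mono) auto
      finally show ?thesis using p by simp
    next
      case False
      have "(1 + norm u) powr (real m * p) \<le> (2 * norm u) powr (real m * p)"
        using False p by (intro powr_mono2) auto
      also have "\<dots> = W * (norm u ^ m) powr p"
      proof -
        have "norm u > 0" using False norm_ge_zero[of u] by (auto simp del: norm_ge_zero)
        then show ?thesis unfolding W_def powr_mult by (simp add: powr_powr flip: powr_realpow)
      qed
      finally have "(1 + norm u) powr (real m * p) * ?F j u powr p \<le> W * (norm u ^ m) powr p * ?F j u powr p"
        by (rule mult_right_mono) simp
      then show ?thesis using False p by (simp add: mult.assoc)
    qed
    then have "(\<integral>\<^sup>+u. ennreal ((1 + norm u) powr (real m * q * p / q) * ?F j u powr p) \<partial>lborel)
        \<le> (\<integral>\<^sup>+u. ennreal (W * (indicator (cball 0 1) u + (norm u ^ m) powr p * ?F j u powr p)) \<partial>lborel)"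
      by (intro nn_integral_mono ennreal_leI)
    also have "\<dots> = (\<integral>\<^sup>+u. ennreal W * (indicator (cball 0 1) u + ennreal ((norm u ^ m) powr p * ?F j u powr p)) \<partial>lborel)"
      using W by (intro nn_integral_cong) (simp add: ennreal_mult ennreal_plus ennreal_indicator)
    also have "\<dots> = ennreal W * ((\<integral>\<^sup>+u. indicator (cball (0 :: complex ^ 'n) 1) u \<partial>lborel) +
        (\<integral>\<^sup>+u. ennreal ((norm u ^ m) powr p * ?F j u powr p) \<partial>lborel))"
    proof -
      have [measurable]: "(\<lambda>u. indicator (cball 0 1) u :: ennreal) \<in> borel_measurable (borel :: (complex ^ 'n) measure)"
        by measurable
      show ?thesis by (subst nn_integral_cmult, simp, subst nn_integral_add) simp_all
    qed
    also have "\<dots> \<le> ennreal W * (ennreal V + ennreal N)"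
      using N[of j] V by (intro mult_left_mono add_mono) simp_all
    also have "\<dots> = ennreal (W * (V + N))"
      using W N0 by (simp add: V_def ennreal_mult)
    finally show ?case .
  qed
  have "(\<lambda>j. \<integral>\<^sup>+u. ennreal (?F j u powr q) \<partial>\<mu>) \<longlonglongrightarrow> 0"
    by (rule carleson_sequence_tendsto_0[OF \<alpha> p _ \<mu> r z avg entire bounded]) (use p unif in auto)
  then show "(\<lambda>j. \<integral>\<^sup>+z. ennreal (norm (f j z) powr q * exp (- (q * \<alpha> / 2) * (norm z)\<^sup>2)) \<partial>\<mu>) \<longlonglongrightarrow> 0"
    by (simp add: fock_weighted_powr mult.commute[of q])
qed

theorem theorem2p2:
  fixes \<mu> :: "(complex ^ 'n) measure"
    and \<alpha> p q :: real
    and m :: nat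
  assumes "\<alpha> > 0" and "0 < p" and "p \<le> q"
    and "positive_borel_measure \<mu>"
  shows
    "(vanishing_fock_carleson p q m \<alpha> \<mu> \<longleftrightarrow>
        (\<exists>t>0. (berezin_transform \<alpha> t (real m * q) \<mu> \<longlongrightarrow> 0) at_infinity)) \<and>
     (vanishing_fock_carleson p q m \<alpha> \<mu> \<longleftrightarrow>
        (\<forall>t>0. (berezin_transform \<alpha> t (real m * q) \<mu> \<longlongrightarrow> 0) at_infinity)) \<and>
     (vanishing_fock_carleson p q m \<alpha> \<mu> \<longleftrightarrow>
        (\<exists>r>0. (averaging_function (real m * q) r \<mu> \<longlongrightarrow> 0) at_infinity)) \<and>
     (vanishing_fock_carleson p q m \<alpha> \<mu> \<longleftrightarrow>
        (\<forall>r>0. (averaging_function (real m * q) r \<mu> \<longlongrightarrow> 0) at_infinity)) \<and>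
     (vanishing_fock_carleson p q m \<alpha> \<mu> \<longleftrightarrow>
        (\<exists>r>0. \<exists>z. half_lattice r z \<and>
           (\<lambda>k. averaging_function (real m * q) r \<mu> (z k)) \<longlonglongrightarrow> 0)) \<and>
     (vanishing_fock_carleson p q m \<alpha> \<mu> \<longleftrightarrow>
        (\<forall>r>0. \<forall>z. half_lattice r z \<longrightarrow>
           (\<lambda>k. averaging_function (real m * q) r \<mu> (z k)) \<longlonglongrightarrow> 0))"
proof -
  define s where "s = real m * q"
  have q: "q > 0" and s: "s \<ge> 0" using assms by (simp_all add: s_def)
  let ?V = "vanishing_fock_carleson p q m \<alpha> \<mu>"
  let ?ber = "\<lambda>t. (berezin_transform \<alpha> t s \<mu> \<longlongrightarrow> 0) at_infinity"
  let ?avg = "\<lambda>r. (averaging_function s r \<mu> \<longlongrightarrow> 0) at_infinity"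
  let ?lat = "\<lambda>r z. (\<lambda>k. averaging_function s r \<mu> (z k)) \<longlonglongrightarrow> 0"
  have V_avg: "?V \<Longrightarrow> ?avg r" for r
    using vanishing_imp_averaging[OF assms(1,2) q assms(4)] by (simp add: s_def)
  have ber_avg: "t > 0 \<Longrightarrow> ?ber t \<Longrightarrow> ?avg r" for t r
    using berezin_imp_averaging[OF assms(1) _ s assms(4)] by blast
  have avg_lat: "r > 0 \<Longrightarrow> ?avg r \<Longrightarrow> half_lattice r z \<Longrightarrow> ?lat r z" for r z
    using half_lattice_at_infinity filterlim_compose by blast
  have lat_V: "r > 0 \<Longrightarrow> half_lattice r z \<Longrightarrow> ?lat r z \<Longrightarrow> ?V" for r z
    using lattice_imp_vanishing[OF assms] by (simp add: s_def)
  have lat_ber: "r > 0 \<Longrightarrow> half_lattice r z \<Longrightarrow> ?lat r z \<Longrightarrow> t > 0 \<Longrightarrow> ?ber t" for r z t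
    using lattice_imp_berezin[OF assms(1) _ s assms(4)] by blast
  have ex_lat: "r > 0 \<Longrightarrow> \<exists>z :: nat \<Rightarrow> complex ^ 'n. half_lattice r z" for r
    by (rule half_lattice_exists)
  have avg_V: "?V" if r: "r > 0" and avg: "?avg r" for r
  proof -
    obtain z :: "nat \<Rightarrow> complex ^ 'n" where z: "half_lattice r z" using ex_lat[OF r] ..
    show ?thesis using lat_V[OF r z avg_lat[OF r avg z]] .
  qed
  have V_lat: "?lat r z" if "?V" "r > 0" "half_lattice r z" for r z
    using avg_lat[OF that(2) V_avg[OF that(1)] that(3)] .
  have one: "(1::real) > 0" by simp
  obtain z1 :: "nat \<Rightarrow> complex ^ 'n" where z1: "half_lattice 1 z1" using ex_lat[OF one] ..
  have V_ber: "?ber t" if "?V" "t > 0" for t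
    using lat_ber[OF one z1 V_lat[OF that(1) one z1] that(2)] .
  have ber_V: "?V" if "t > 0" "?ber t" for t
    using avg_V[OF one ber_avg[OF that]] .
  have "?V \<longleftrightarrow> (\<exists>t>0. ?ber t)" using V_ber[OF _ one] ber_V one by metis
  moreover have "?V \<longleftrightarrow> (\<forall>t>0. ?ber t)" using V_ber ber_V[OF one] one by metis
  moreover have "?V \<longleftrightarrow> (\<exists>r>0. ?avg r)" using V_avg avg_V one by metis
  moreover have "?V \<longleftrightarrow> (\<forall>r>0. ?avg r)" using V_avg avg_V[OF one] one by metis
  moreover have "?V \<longleftrightarrow> (\<exists>r>0. \<exists>z. half_lattice r z \<and> ?lat r z)"
    using V_lat[OF _ one z1] lat_V one z1 by metis
  moreover have "?V \<longleftrightarrow> (\<forall>r>0. \<forall>z. half_lattice r z \<longrightarrow> ?lat r z)"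
    using V_lat lat_V[OF one z1] one z1 by metis
  ultimately show ?thesis by (simp only: s_def)
qed

end
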